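(* There is a universal constant $C>0$ such that the following holds. Let $d\ge2$, let $z_1,\dots,z_n\in\mathbb{R}^d$, and let $A=\sum_{i=1}^n z_iz_i^\top$ have eigenvalues $\lambda_1>\lambda_2\ge\dots\ge\lambda_d$; put $\delta=\lambda_1-\lambda_2$. Let $f(x)=-x^\top Ax$ on the unit sphere $\mathbb{S}^{d-1}$, and let $p\in(0,1)$. Let $x^0$ be a random initialization, uniformly distributed on $\mathbb{S}^{d-1}$. Then there is a radius $r>0$ such that: (i) with probability at least $1-p$, $x^0$ lies in a Riemannian ball (closed geodesic ball of $\mathbb{S}^{d-1}$) of radius $r$ centered at a global minimizer of $f$ on $\mathbb{S}^{d-1}$; and (ii) within every such ball of radius $r$ centered at a global minimizer, $f$ is $\tau$-gradient dominated with $\tau=C\,\frac{d}{p^2\delta}$, i.e. $f(x)-\min_{\mathbb{S}^{d-1}}f\le\tau\,\|\nabla f(x)\|^2$ for all $x$ in the ball.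
   Context: $\mathbb{S}^{d-1}=\{x\in\mathbb{R}^d:x^\top x=1\}$ carries the Riemannian metric induced from $\mathbb{R}^d$, and $\nabla f(x)$ denotes the Riemannian gradient of $f$ on $\mathbb{S}^{d-1}$, i.e. the orthogonal projection $(I-xx^\top)(-2Ax)$ of the Euclidean gradient onto the tangent space at $x$, with $\|\cdot\|$ the Euclidean norm. *)

theory Defs
  imports "HOL-Analysis.Analysis" "Jordan_Normal_Form.Char_Poly"
begin

text \<open>
  The dimension is quantified inside the statement (the constant is independent of it), so vectors
  and matrices are those of the AFP entry on Jordan normal forms, with explicit carriers.
\<close>

hide_type (open) Finite_Cartesian_Product.vec
hide_const (open) Finite_Cartesian_Product.vec
no_notation Finite_Cartesian_Product.vec_nth (infixl \<open>$\<close> 90)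
no_notation inner (infix \<open>\<bullet>\<close> 70)

definition vnorm :: "real vec \<Rightarrow> real" where
  "vnorm x = sqrt (x \<bullet> x)"

definition outer_prod :: "real vec \<Rightarrow> real vec \<Rightarrow> real mat" where
  "outer_prod x y = mat (dim_vec x) (dim_vec y) (\<lambda>(j, k). x $ j * y $ k)"

text \<open>The matrix \<open>z\<^sub>1 z\<^sub>1\<^sup>T + \<dots> + z\<^sub>n z\<^sub>n\<^sup>T\<close>; the library has no zero
  matrix independent of the dimension, hence no \<open>sum\<close> over matrices.\<close>

definition sum_outer :: "nat \<Rightarrow> nat \<Rightarrow> (nat \<Rightarrow> real vec) \<Rightarrow> real mat" where
  "sum_outer d n z = mat d d (\<lambda>(j, k). \<Sum>i=1..n. outer_prod (z i) (z i) $$ (j, k))"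

definition sphere_vec :: "nat \<Rightarrow> real vec set" where
  "sphere_vec d = {x \<in> carrier_vec d. x \<bullet> x = 1}"

text \<open>\<open>C1_differentiable_on\<close> asks for two-sided derivatives also at \<open>0\<close> and \<open>1\<close>. This is no restriction:
  a \<open>C\<^sup>1\<close> curve on \<open>[0,1]\<close> extends beyond it, and the values there need not lie on the sphere.\<close>

definition sphere_curves :: "nat \<Rightarrow> real vec \<Rightarrow> real vec \<Rightarrow> (real \<Rightarrow> real vec) set" where
  "sphere_curves d x y = {\<gamma>. (\<forall>t\<in>{0..1}. \<gamma> t \<in> sphere_vec d) \<and> \<gamma> 0 = x \<and> \<gamma> 1 = y \<and>
     (\<forall>i<d. (\<lambda>t. \<gamma> t $ i) C1_differentiable_on {0..1})}"

definition velocity :: "nat \<Rightarrow> (real \<Rightarrow> real vec) \<Rightarrow> real \<Rightarrow> real vec" where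
  "velocity d \<gamma> t = vec d (\<lambda>i. deriv (\<lambda>s. \<gamma> s $ i) t)"

definition curve_length :: "nat \<Rightarrow> (real \<Rightarrow> real vec) \<Rightarrow> real" where
  "curve_length d \<gamma> = integral {0..1} (\<lambda>t. vnorm (velocity d \<gamma> t))"

definition sphere_dist :: "nat \<Rightarrow> real vec \<Rightarrow> real vec \<Rightarrow> real" where
  "sphere_dist d x y = (INF \<gamma> \<in> sphere_curves d x y. curve_length d \<gamma>)"

definition sphere_cball :: "nat \<Rightarrow> real vec \<Rightarrow> real \<Rightarrow> real vec set" where
  "sphere_cball d c r = {x \<in> sphere_vec d. sphere_dist d c x \<le> r}"

definition eucl_grad :: "nat \<Rightarrow> (real vec \<Rightarrow> real) \<Rightarrow> real vec \<Rightarrow> real vec" where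
  "eucl_grad d f x = vec d (\<lambda>i. deriv (\<lambda>t. f (x + t \<cdot>\<^sub>v unit_vec d i)) 0)"

definition sphere_grad :: "nat \<Rightarrow> (real vec \<Rightarrow> real) \<Rightarrow> real vec \<Rightarrow> real vec" where
  "sphere_grad d f x = (1\<^sub>m d - outer_prod x x) *\<^sub>v eucl_grad d f x"

definition gradient_dominated_on :: "nat \<Rightarrow> (real vec \<Rightarrow> real) \<Rightarrow> real \<Rightarrow> real vec set \<Rightarrow> bool" where
  "gradient_dominated_on d f \<tau> B \<longleftrightarrow>
     (\<forall>x\<in>B. f x - (INF y\<in>sphere_vec d. f y) \<le> \<tau> * (vnorm (sphere_grad d f x))\<^sup>2)"

definition neg_quad_form :: "real mat \<Rightarrow> real vec \<Rightarrow> real" where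
  "neg_quad_form A x = - (x \<bullet> (A *\<^sub>v x))"

lemma sum_outer_carrier: "sum_outer d n z \<in> carrier_mat d d"
  by (simp add: sum_outer_def)

lemma transpose_sum_outer:
  assumes z: "\<And>i. i \<in> {1..n} \<Longrightarrow> z i \<in> carrier_vec d"
  shows "(sum_outer d n z)\<^sup>T = sum_outer d n z"
proof -
  have "outer_prod (z i) (z i) $$ (k, j) = outer_prod (z i) (z i) $$ (j, k)"
    if "i \<in> {1..n}" "j < d" "k < d" for i j k
    using z[OF that(1)] that by (simp add: outer_prod_def)
  then show ?thesis by (intro eq_matI) (auto simp: sum_outer_def intro!: sum.cong)
qed

lemma sphere_grad_neg_quad_form:
  assumes A: "A \<in> carrier_mat d d" and sym: "A\<^sup>T = A" and x: "x \<in> carrier_vec d"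
  shows "sphere_grad d (neg_quad_form A) x = (1\<^sub>m d - outer_prod x x) *\<^sub>v ((- 2) \<cdot>\<^sub>v (A *\<^sub>v x))"
proof -
  have "deriv (\<lambda>t. neg_quad_form A (x + t \<cdot>\<^sub>v unit_vec d i)) 0 = - 2 * (A *\<^sub>v x) $ i"
    if i: "i < d" for i
  proof -
    let ?e = "unit_vec d i :: real vec"
    have e: "?e \<in> carrier_vec d" by simp
    have Ax: "A *\<^sub>v x \<in> carrier_vec d" and Ae: "A *\<^sub>v ?e \<in> carrier_vec d"
      using A x e by auto
    have xe: "x \<bullet> (A *\<^sub>v ?e) = ?e \<bullet> (A *\<^sub>v x)"
      using transpose_vec_mult_scalar[OF A e x] sym comm_scalar_prod[OF e Ax] by simp
    have ei: "?e \<bullet> (A *\<^sub>v x) = (A *\<^sub>v x) $ i"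
      using i Ax by simp
    have eq: "neg_quad_form A (x + t \<cdot>\<^sub>v ?e)
        = - (x \<bullet> (A *\<^sub>v x)) - 2 * t * (A *\<^sub>v x) $ i - t\<^sup>2 * (?e \<bullet> (A *\<^sub>v ?e))" for t
    proof -
      have "A *\<^sub>v (x + t \<cdot>\<^sub>v ?e) = A *\<^sub>v x + t \<cdot>\<^sub>v (A *\<^sub>v ?e)"
        using A x e by (simp add: mult_add_distrib_mat_vec[of A d d] mult_mat_vec[of A d d])
      moreover have "(x + t \<cdot>\<^sub>v ?e) \<bullet> (A *\<^sub>v x + t \<cdot>\<^sub>v (A *\<^sub>v ?e))
         = x \<bullet> (A *\<^sub>v x) + t * (x \<bullet> (A *\<^sub>v ?e)) + t * (?e \<bullet> (A *\<^sub>v x))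
           + t * t * (?e \<bullet> (A *\<^sub>v ?e))"
        using x e Ax Ae
        by (subst add_scalar_prod_distrib[of _ d], simp_all add: scalar_prod_add_distrib[of _ d]
              smult_scalar_prod_distrib[of _ d] scalar_prod_smult_distrib[of _ d] algebra_simps)
      ultimately show ?thesis
        unfolding neg_quad_form_def by (simp add: xe ei power2_eq_square algebra_simps)
    qed
    have "((\<lambda>t. neg_quad_form A (x + t \<cdot>\<^sub>v ?e)) has_field_derivative (- 2 * (A *\<^sub>v x) $ i)) (at 0)"
      unfolding eq by (auto intro!: derivative_eq_intros)
    then show ?thesis by (rule DERIV_imp_deriv)
  qed
  then have "eucl_grad d (neg_quad_form A) x = (- 2) \<cdot>\<^sub>v (A *\<^sub>v x)"
    unfolding eucl_grad_def using A x by (intro eq_vecI) auto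
  then show ?thesis by (simp add: sphere_grad_def)
qed

definition borel_vec :: "nat \<Rightarrow> real vec measure" where
  "borel_vec d =
     vimage_algebra (carrier_vec d) (\<lambda>x. \<lambda>i\<in>{..<d}. x $ i) (\<Pi>\<^sub>M i\<in>{..<d}. borel)"

definition lborel_vec :: "nat \<Rightarrow> real vec measure" where
  "lborel_vec d = distr (\<Pi>\<^sub>M i\<in>{..<d}. lborel) (borel_vec d) (vec d)"

text \<open>Normalized surface measure as cone measure: the law of \<open>x / \<parallel>x\<parallel>\<close> for \<open>x\<close> uniform in the unit
  ball. The origin, where the quotient is the zero vector, is a null set.\<close>

definition uniform_sphere :: "nat \<Rightarrow> real vec measure" where
  "uniform_sphere d =
     distr (uniform_measure (lborel_vec d) {x \<in> carrier_vec d. vnorm x \<le> 1}) (borel_vec d)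
       (\<lambda>x. (1 / vnorm x) \<cdot>\<^sub>v x)"

end

theory Submission
  imports Defs
begin

text \<open>
  Let \<open>\<kappa>\<close> and \<open>\<mu>\<close> be the two largest eigenvalues and let \<open>v\<close> be a unit eigenvector for \<open>\<kappa>\<close>. For a
  unit vector \<open>x\<close> write \<open>s = v \<bullet> x\<close> and let \<open>g = f x + \<kappa>\<close> be the excess of \<open>f\<close> over its
  minimum \<open>-\<kappa>\<close>. Splitting off \<open>v\<close> by a Householder reflection and bounding the quadratic form on
  the orthogonal complement by \<open>\<mu>\<close> gives \<open>(\<kappa> - \<mu>) (1 - s\<^sup>2) \<le> g\<close>
  (\<open>ex_leading_eigenvector\<close>); in particular the minimizers are exactly \<open>v\<close> and \<open>-v\<close>.

  The tangent vector \<open>v - s x\<close> at \<open>x\<close>, which points towards \<open>v\<close>, has squared length \<open>1 - s\<^sup>2\<close>, and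
  its inner product with the Riemannian gradient is \<open>-2 g s\<close>. By Cauchy-Schwarz
  \<open>4 g\<^sup>2 s\<^sup>2 \<le> \<parallel>\<nabla>f\<parallel>\<^sup>2 (1 - s\<^sup>2) \<le> \<parallel>\<nabla>f\<parallel>\<^sup>2 g / (\<kappa> - \<mu>)\<close>, hence
  \<open>4 (\<kappa> - \<mu>) s\<^sup>2 g \<le> \<parallel>\<nabla>f\<parallel>\<^sup>2\<close> (\<open>excess_le_gradient\<close>). So \<open>f\<close> is gradient dominated with
  constant \<open>1 / (4 (\<kappa> - \<mu>) a\<^sup>2)\<close> on the caps \<open>\<bar>s\<bar> \<ge> a\<close>. Since the geodesic distance
  between unit vectors is the angle between them (\<open>sphere_dist_eq_arccos\<close>), these caps are the
  geodesic balls of radius \<open>arccos a\<close> about \<open>v\<close> and \<open>-v\<close>.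

  The choice \<open>a = p / (12 \<surd>d)\<close> makes the constant \<open>36 d / (p\<^sup>2 (\<kappa> - \<mu>))\<close>, and a uniform
  random point misses both caps with probability at most \<open>p\<close> (\<open>measure_uniform_sphere_caps_ge\<close>).
  For the latter it suffices that the slab \<open>\<bar>y \<bullet> v\<bar> < a\<close> of the unit ball has at most the
  fraction \<open>p\<close> of the volume of the ball. Shrunk by the factor \<open>exp (-1/d)\<close>, which costs only a
  factor \<open>e\<close> in volume, the slab leaves a margin of order \<open>1/d\<close> below the squared radius, so it
  can be translated along \<open>v\<close> by up to \<open>1 / (2 \<surd>d)\<close> inside the ball; at least \<open>3 / p\<close>
  pairwise disjoint translates fit (\<open>emeasure_ball_slab_le\<close>).
\<close>

section \<open>Curves on the sphere and geodesic distance\<close>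

lemma scalar_prod_sum_lessThan:
  "y \<in> carrier_vec d \<Longrightarrow> x \<bullet> y = (\<Sum>i<d. x $ i * y $ i)"
  by (simp add: scalar_prod_def lessThan_atLeast0)

lemma scalar_prod_Cauchy_Schwarz:
  fixes x y :: "real vec"
  assumes "x \<in> carrier_vec d" "y \<in> carrier_vec d"
  shows "(x \<bullet> y)\<^sup>2 \<le> (x \<bullet> x) * (y \<bullet> y)"
  using Cauchy_Schwarz_ineq_sum[of "\<lambda>i. x $ i" "\<lambda>i. y $ i" "{..<d}"] assms
  by (simp add: scalar_prod_sum_lessThan[of _ d] power2_eq_square)

lemma sphere_vec_scalar_prod_bounds:
  assumes "c \<in> sphere_vec d" "x \<in> sphere_vec d"
  shows "- 1 \<le> c \<bullet> x" "c \<bullet> x \<le> 1"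
proof -
  have "(c \<bullet> x)\<^sup>2 \<le> 1"
    using scalar_prod_Cauchy_Schwarz[of c d x] assms by (simp add: sphere_vec_def)
  then show "- 1 \<le> c \<bullet> x" "c \<bullet> x \<le> 1"
    by (auto simp: abs_square_le_1 abs_le_iff)
qed

lemma vnorm_nonneg: "0 \<le> vnorm x"
  by (simp add: vnorm_def scalar_prod_def sum_nonneg)

lemma sphere_curve_velocity:
  assumes "\<gamma> \<in> sphere_curves d x y"
  shows "\<And>i t. i < d \<Longrightarrow> t \<in> {0..1} \<Longrightarrow>
           ((\<lambda>s. \<gamma> s $ i) has_real_derivative velocity d \<gamma> t $ i) (at t)"
    and "\<And>i. i < d \<Longrightarrow> continuous_on {0..1} (\<lambda>t. velocity d \<gamma> t $ i)"
    and "continuous_on {0..1} (\<lambda>t. vnorm (velocity d \<gamma> t))"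
proof -
  have C1: "(\<lambda>t. \<gamma> t $ i) C1_differentiable_on {0..1}" if "i < d" for i
    using assms that by (simp add: sphere_curves_def)
  have *: "(\<forall>t\<in>{0..1}. ((\<lambda>s. \<gamma> s $ i) has_real_derivative velocity d \<gamma> t $ i) (at t)) \<and>
      continuous_on {0..1} (\<lambda>t. velocity d \<gamma> t $ i)" if i: "i < d" for i
  proof -
    obtain D where D: "\<And>t. t \<in> {0..1} \<Longrightarrow> ((\<lambda>s. \<gamma> s $ i) has_vector_derivative D t) (at t)"
      "continuous_on {0..1} D"
      using C1[OF i] unfolding C1_differentiable_on_def by blast
    have r: "((\<lambda>s. \<gamma> s $ i) has_real_derivative D t) (at t)" if "t \<in> {0..1}" for t
      using D(1)[OF that] by (simp add: has_real_derivative_iff_has_vector_derivative)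
    then have "velocity d \<gamma> t $ i = D t" if "t \<in> {0..1}" for t
      using that i by (simp add: velocity_def DERIV_imp_deriv)
    with r continuous_on_eq[OF D(2)] show ?thesis by auto
  qed
  show "\<And>i t. i < d \<Longrightarrow> t \<in> {0..1} \<Longrightarrow>
           ((\<lambda>s. \<gamma> s $ i) has_real_derivative velocity d \<gamma> t $ i) (at t)"
    and cont: "\<And>i. i < d \<Longrightarrow> continuous_on {0..1} (\<lambda>t. velocity d \<gamma> t $ i)"
    using * by auto
  have "vnorm (velocity d \<gamma> t) = sqrt (\<Sum>i<d. velocity d \<gamma> t $ i * velocity d \<gamma> t $ i)" for t
    by (simp add: vnorm_def scalar_prod_sum_lessThan[of _ d] velocity_def)
  then show "continuous_on {0..1} (\<lambda>t. vnorm (velocity d \<gamma> t))"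
    by (auto intro!: continuous_intros cont)
qed

text \<open>
  The height \<open>c \<bullet> \<gamma>\<close> of a spherical curve over a fixed point \<open>c\<close> changes at most at the rate
  \<open>\<parallel>\<gamma>'\<parallel> \<surd>(1 - (c \<bullet> \<gamma>)\<^sup>2)\<close>: since \<open>\<gamma>'\<close> is orthogonal to \<open>\<gamma>\<close>, only the tangential part
  of \<open>c\<close> matters. The parameter is restricted to the open interval because off \<open>[0,1]\<close> the curve
  need not stay on the sphere.
\<close>

lemma sphere_curve_height_derivative:
  assumes \<gamma>: "\<gamma> \<in> sphere_curves d x y" and c: "c \<in> sphere_vec d" and t: "t \<in> {0<..<1}"
  shows "((\<lambda>s. c \<bullet> \<gamma> s) has_real_derivative c \<bullet> velocity d \<gamma> t) (at t)"
    and "\<bar>c \<bullet> velocity d \<gamma> t\<bar> \<le> vnorm (velocity d \<gamma> t) * sqrt (1 - (c \<bullet> \<gamma> t)\<^sup>2)"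
proof -
  let ?w = "velocity d \<gamma> t"
  have w: "?w \<in> carrier_vec d" by (simp add: velocity_def)
  have sph: "\<gamma> s \<in> carrier_vec d" "\<gamma> s \<bullet> \<gamma> s = 1" if "s \<in> {0..1}" for s
    using \<gamma> that by (auto simp: sphere_curves_def sphere_vec_def)
  have der: "((\<lambda>s. \<gamma> s $ i) has_real_derivative ?w $ i) (at t)" if "i < d" for i
    using sphere_curve_velocity(1)[OF \<gamma> that] t by simp
  have ev: "\<forall>\<^sub>F s in nhds t. s \<in> {0<..<1}"
    using t by (intro eventually_nhds_in_open) auto
  have "((\<lambda>s. \<Sum>i<d. c $ i * \<gamma> s $ i) has_real_derivative (\<Sum>i<d. c $ i * ?w $ i)) (at t)"
    by (intro DERIV_sum DERIV_cmult der) auto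
  then show "((\<lambda>s. c \<bullet> \<gamma> s) has_real_derivative c \<bullet> ?w) (at t)"
    unfolding scalar_prod_sum_lessThan[OF w]
    by (rule DERIV_cong_ev[THEN iffD2, rotated -1])
       (auto intro!: eventually_mono[OF ev] simp: scalar_prod_sum_lessThan[of _ d] sph)
  have "((\<lambda>s. \<Sum>i<d. \<gamma> s $ i * \<gamma> s $ i) has_real_derivative (\<Sum>i<d. 2 * (\<gamma> t $ i * ?w $ i))) (at t)"
    by (auto intro!: derivative_eq_intros der sum.cong)
  moreover have "((\<lambda>s. \<Sum>i<d. \<gamma> s $ i * \<gamma> s $ i) has_real_derivative 0) (at t)"
  proof (rule DERIV_cong_ev[THEN iffD2, rotated -1])
    show "((\<lambda>s. 1) has_real_derivative 0) (at t)" by simp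
    show "\<forall>\<^sub>F s in nhds t. (\<Sum>i<d. \<gamma> s $ i * \<gamma> s $ i) = 1"
      by (rule eventually_mono[OF ev])
         (use sph in \<open>auto simp: scalar_prod_sum_lessThan[of _ d]\<close>)
  qed auto
  ultimately have "(\<Sum>i<d. 2 * (\<gamma> t $ i * ?w $ i)) = 0" by (rule DERIV_unique)
  then have tangent: "\<gamma> t \<bullet> ?w = 0"
    by (simp add: scalar_prod_sum_lessThan[OF w] sum_distrib_left[symmetric])
  let ?h = "c \<bullet> \<gamma> t"
  let ?u = "c - ?h \<cdot>\<^sub>v \<gamma> t"
  have g: "\<gamma> t \<in> carrier_vec d" "\<gamma> t \<bullet> \<gamma> t = 1" using sph t by auto
  have cc: "c \<in> carrier_vec d" "c \<bullet> c = 1" using c by (auto simp: sphere_vec_def)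
  have u: "?u \<in> carrier_vec d" using g cc by simp
  have uw: "?u \<bullet> ?w = c \<bullet> ?w"
    using g cc w tangent by (simp add: minus_scalar_prod_distrib[of _ d])
  have uu: "?u \<bullet> ?u = 1 - ?h\<^sup>2"
    using g cc comm_scalar_prod[OF cc(1) g(1)]
    by (simp add: minus_scalar_prod_distrib[of _ d] scalar_prod_minus_distrib[of _ d]
        power2_eq_square algebra_simps)
  have "(c \<bullet> ?w)\<^sup>2 \<le> (1 - ?h\<^sup>2) * (?w \<bullet> ?w)"
    using scalar_prod_Cauchy_Schwarz[OF u w] by (simp add: uw uu)
  then have "sqrt ((c \<bullet> ?w)\<^sup>2) \<le> sqrt ((1 - ?h\<^sup>2) * (?w \<bullet> ?w))"
    by (rule real_sqrt_le_mono)
  then show "\<bar>c \<bullet> ?w\<bar> \<le> vnorm ?w * sqrt (1 - ?h\<^sup>2)"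
    by (simp add: vnorm_def real_sqrt_mult mult.commute)
qed

text \<open>
  The angle to \<open>c\<close> grows at most at unit speed along the curve. As \<open>arccos\<close> is not differentiable
  at \<open>1\<close> and \<open>-1\<close>, the height is first scaled by some \<open>\<sigma> < 1\<close>, and then \<open>\<sigma>\<close> tends to \<open>1\<close>.
\<close>

lemma arccos_le_curve_length:
  assumes c: "c \<in> sphere_vec d" and \<gamma>: "\<gamma> \<in> sphere_curves d c x"
  shows "arccos (c \<bullet> x) \<le> curve_length d \<gamma>"
proof -
  let ?h = "\<lambda>t. c \<bullet> \<gamma> t"
  have sph: "\<gamma> t \<in> sphere_vec d" if "t \<in> {0..1}" for t
    using \<gamma> that by (auto simp: sphere_curves_def)
  have ends: "\<gamma> 0 = c" "\<gamma> 1 = x" using \<gamma> by (auto simp: sphere_curves_def)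
  have cc: "c \<bullet> c = 1" using c by (simp add: sphere_vec_def)
  have hb: "- 1 \<le> ?h t" "?h t \<le> 1" if "t \<in> {0..1}" for t
    using sphere_vec_scalar_prod_bounds[OF c sph[OF that]] by auto
  have hcont: "continuous_on {0..1} ?h"
  proof -
    have "continuous_on {0..1} (\<lambda>t. \<Sum>i<d. c $ i * \<gamma> t $ i)"
      by (intro continuous_intros continuous_at_imp_continuous_on ballI DERIV_isCont)
         (use sphere_curve_velocity(1)[OF \<gamma>] in auto)
    then show ?thesis
      by (rule continuous_on_eq)
         (use sph in \<open>auto simp: scalar_prod_sum_lessThan[of _ d] sphere_vec_def\<close>)
  qed
  have scaled: "arccos (\<sigma> * (c \<bullet> x)) - arccos \<sigma> \<le> curve_length d \<gamma>" if \<sigma>: "0 < \<sigma>" "\<sigma> < 1" for \<sigma>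
  proof -
    have sb: "- 1 < \<sigma> * ?h t" "\<sigma> * ?h t < 1" "\<bar>\<sigma> * ?h t\<bar> < 1" if "t \<in> {0..1}" for t
    proof -
      have "\<bar>\<sigma> * ?h t\<bar> \<le> \<sigma> * 1" using hb[OF that] \<sigma> unfolding abs_mult by (intro mult_mono) auto
      then show "- 1 < \<sigma> * ?h t" "\<sigma> * ?h t < 1" "\<bar>\<sigma> * ?h t\<bar> < 1" using \<sigma> by linarith+
    qed
    \<comment> \<open>The value at the end points is irrelevant for the integral, and \<open>0\<close> keeps the bound valid there.\<close>
    let ?k = "\<lambda>t. if t \<in> {0<..<1}
      then \<sigma> * (c \<bullet> velocity d \<gamma> t) * inverse (- sqrt (1 - (\<sigma> * ?h t)\<^sup>2)) else 0"
    have "(?k has_integral arccos (\<sigma> * ?h 1) - arccos (\<sigma> * ?h 0)) {0..1}"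
    proof (rule fundamental_theorem_of_calculus_interior)
      show "continuous_on {0..1} (\<lambda>t. arccos (\<sigma> * ?h t))"
        using sb by (intro continuous_intros hcont) (auto intro: less_imp_le)
      fix t :: real assume t: "t \<in> {0<..<1}"
      then have t': "t \<in> {0..1}" by auto
      have "((\<lambda>s. arccos (\<sigma> * ?h s)) has_real_derivative
              inverse (- sqrt (1 - (\<sigma> * ?h t)\<^sup>2)) * (\<sigma> * (c \<bullet> velocity d \<gamma> t))) (at t)"
        by (rule DERIV_chain2[OF DERIV_arccos])
           (use sb[OF t'] in \<open>auto intro!: DERIV_cmult sphere_curve_height_derivative(1)[OF \<gamma> c t]\<close>)
      then show "((\<lambda>t. arccos (\<sigma> * ?h t)) has_vector_derivative ?k t) (at t)"
        using t by (simp add: has_real_derivative_iff_has_vector_derivative mult.commute)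
    qed simp
    moreover have "((\<lambda>t. vnorm (velocity d \<gamma> t)) has_integral curve_length d \<gamma>) {0..1}"
      unfolding curve_length_def
      by (intro integrable_integral integrable_continuous_real sphere_curve_velocity(3)[OF \<gamma>])
    ultimately have "arccos (\<sigma> * ?h 1) - arccos (\<sigma> * ?h 0) \<le> curve_length d \<gamma>"
    proof (rule has_integral_le)
      fix t :: real assume t': "t \<in> {0..1}"
      show "?k t \<le> vnorm (velocity d \<gamma> t)"
      proof (cases "t \<in> {0<..<1}")
        case True
        let ?V = "vnorm (velocity d \<gamma> t)" and ?q = "sqrt (1 - (\<sigma> * ?h t)\<^sup>2)"
        have V: "?V \<ge> 0" by (rule vnorm_nonneg)
        have q: "?q > 0" using sb(3)[OF t'] by (simp add: abs_square_less_1)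
        have "(\<sigma> * ?h t)\<^sup>2 \<le> 1 * (?h t)\<^sup>2"
          unfolding power_mult_distrib using \<sigma> by (intro mult_right_mono power_le_one) auto
        then have "sqrt (1 - (?h t)\<^sup>2) \<le> ?q" by simp
        then have "?V * sqrt (1 - (?h t)\<^sup>2) \<le> ?V * ?q" using V by (intro mult_left_mono)
        then have "\<bar>c \<bullet> velocity d \<gamma> t\<bar> \<le> ?V * ?q"
          using sphere_curve_height_derivative(2)[OF \<gamma> c True] by linarith
        then have "\<sigma> * \<bar>c \<bullet> velocity d \<gamma> t\<bar> \<le> 1 * (?V * ?q)"
          using \<sigma> by (intro mult_mono) auto
        moreover have "- (\<sigma> * (c \<bullet> velocity d \<gamma> t)) \<le> \<sigma> * \<bar>c \<bullet> velocity d \<gamma> t\<bar>"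
          using \<sigma> by (metis abs_ge_minus_self abs_mult abs_of_pos)
        ultimately have "- (\<sigma> * (c \<bullet> velocity d \<gamma> t)) \<le> ?V * ?q" by linarith
        then have "- (\<sigma> * (c \<bullet> velocity d \<gamma> t)) / ?q \<le> ?V"
          using q by (simp only: pos_divide_le_eq)
        then show ?thesis using True by (simp add: divide_inverse)
      next
        case False
        then show ?thesis by (simp only: if_False vnorm_nonneg)
      qed
    qed
    then show ?thesis by (simp add: ends cc)
  qed
  have "((\<lambda>\<sigma>. arccos (\<sigma> * (c \<bullet> x)) - arccos \<sigma>) \<longlongrightarrow> arccos (1 * (c \<bullet> x)) - arccos 1) (at_left 1)"
  proof (rule continuous_on_Icc_at_leftD)
    have "\<bar>\<sigma> * (c \<bullet> x)\<bar> \<le> 1" if "\<sigma> \<in> {0..1}" for \<sigma> :: real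
    proof -
      have "\<bar>\<sigma> * (c \<bullet> x)\<bar> \<le> 1 * 1"
        using hb[of 1] that unfolding abs_mult ends by (intro mult_mono) auto
      then show ?thesis by simp
    qed
    then show "continuous_on {0..1} (\<lambda>\<sigma>. arccos (\<sigma> * (c \<bullet> x)) - arccos \<sigma>)"
      by (intro continuous_intros) (auto simp: abs_le_iff)
  qed simp
  then have "arccos (1 * (c \<bullet> x)) - arccos 1 \<le> curve_length d \<gamma>"
    by (rule tendsto_upperbound)
       (auto intro!: scaled eventually_mono[OF eventually_at_left_real[of 0 1]])
  then show ?thesis by simp
qed

lemma scalar_prod_self_eq_0_iff:
  fixes x :: "real vec"
  assumes "x \<in> carrier_vec d"
  shows "x \<bullet> x = 0 \<longleftrightarrow> x = 0\<^sub>v d"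
  using conjugate_square_eq_0_vec[OF assms] by simp

lemma scalar_prod_self_diff_projection:
  fixes c x :: "real vec"
  assumes "c \<in> sphere_vec d" "x \<in> carrier_vec d"
  shows "(x - (c \<bullet> x) \<cdot>\<^sub>v c) \<bullet> (x - (c \<bullet> x) \<cdot>\<^sub>v c) = x \<bullet> x - (c \<bullet> x)\<^sup>2"
    and "c \<bullet> (x - (c \<bullet> x) \<cdot>\<^sub>v c) = 0"
proof -
  have c: "c \<in> carrier_vec d" "c \<bullet> c = 1" using assms by (auto simp: sphere_vec_def)
  show "(x - (c \<bullet> x) \<cdot>\<^sub>v c) \<bullet> (x - (c \<bullet> x) \<cdot>\<^sub>v c) = x \<bullet> x - (c \<bullet> x)\<^sup>2"
    and "c \<bullet> (x - (c \<bullet> x) \<cdot>\<^sub>v c) = 0"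
    using c assms(2) comm_scalar_prod[OF c(1) assms(2)]
    by (simp_all add: minus_scalar_prod_distrib[of _ d] scalar_prod_minus_distrib[of _ d]
        power2_eq_square algebra_simps)
qed

lemma sphere_vec_eq_smult:
  fixes c x :: "real vec"
  assumes "c \<in> sphere_vec d" "x \<in> sphere_vec d" "(c \<bullet> x)\<^sup>2 = 1"
  shows "x = (c \<bullet> x) \<cdot>\<^sub>v c"
proof -
  have car: "c \<in> carrier_vec d" "x \<in> carrier_vec d" using assms by (auto simp: sphere_vec_def)
  have "x - (c \<bullet> x) \<cdot>\<^sub>v c = 0\<^sub>v d"
    using scalar_prod_self_eq_0_iff[of "x - (c \<bullet> x) \<cdot>\<^sub>v c" d] car
      scalar_prod_self_diff_projection(1)[OF assms(1) car(2)] assms(2,3)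
    by (simp add: sphere_vec_def)
  then have "(x - (c \<bullet> x) \<cdot>\<^sub>v c) $ i = 0" if "i < d" for i
    using that by simp
  then show ?thesis using car by (intro eq_vecI) auto
qed

lemma sphere_vec_normalize_tangent:
  fixes c u :: "real vec"
  assumes c: "c \<in> sphere_vec d" and u: "u \<in> carrier_vec d" "c \<bullet> u = 0" "u \<bullet> u > 0"
  shows "(1 / sqrt (u \<bullet> u)) \<cdot>\<^sub>v u \<in> sphere_vec d" "c \<bullet> ((1 / sqrt (u \<bullet> u)) \<cdot>\<^sub>v u) = 0"
  using assms by (auto simp: sphere_vec_def)

lemma ex_unit_orthogonal:
  fixes c :: "real vec"
  assumes d: "d \<ge> 2" and c: "c \<in> sphere_vec d"
  shows "\<exists>w\<in>sphere_vec d. c \<bullet> w = 0"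
proof -
  have cc: "c \<in> carrier_vec d" "c \<bullet> c = 1" using c by (auto simp: sphere_vec_def)
  have "(\<Sum>i\<in>{0, 1}. c $ i * c $ i) \<le> (\<Sum>i<d. c $ i * c $ i)"
    using d by (intro sum_mono2) auto
  then have "(c $ 0)\<^sup>2 + (c $ 1)\<^sup>2 \<le> 1"
    using cc by (simp add: scalar_prod_sum_lessThan[of _ d] power2_eq_square)
  then have "(c $ 0)\<^sup>2 < 1 \<or> (c $ 1)\<^sup>2 < 1" by linarith
  moreover have "0 < d" "1 < d" using d by auto
  ultimately obtain i where i: "i < d" "(c $ i)\<^sup>2 < 1" by blast
  let ?e = "unit_vec d i :: real vec"
  let ?u = "?e - (c \<bullet> ?e) \<cdot>\<^sub>v c"
  have e: "?e \<in> carrier_vec d" by simp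
  have "?u \<bullet> ?u > 0"
    using scalar_prod_self_diff_projection(1)[OF c e] i cc by simp
  moreover have "?u \<in> carrier_vec d" using cc by simp
  ultimately show ?thesis
    using sphere_vec_normalize_tangent[OF c _ scalar_prod_self_diff_projection(2)[OF c e]] by blast
qed

text \<open>
  Every \<open>x\<close> lies on a great circle through \<open>c\<close>. For \<open>x = c\<close> and \<open>x = -c\<close> the direction \<open>w\<close> is
  arbitrary; its existence is where the dimension must be at least two.
\<close>

lemma sphere_vec_polar:
  assumes d: "d \<ge> 2" and c: "c \<in> sphere_vec d" and x: "x \<in> sphere_vec d"
  shows "\<exists>w\<in>sphere_vec d. c \<bullet> w = 0 \<and>
           x = cos (arccos (c \<bullet> x)) \<cdot>\<^sub>v c + sin (arccos (c \<bullet> x)) \<cdot>\<^sub>v w"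
proof -
  let ?h = "c \<bullet> x"
  have hb: "- 1 \<le> ?h" "?h \<le> 1" using sphere_vec_scalar_prod_bounds[OF c x] .
  have trig: "cos (arccos ?h) = ?h" "sin (arccos ?h) = sqrt (1 - ?h\<^sup>2)"
    using hb by (auto intro: sin_arccos)
  have car: "c \<in> carrier_vec d" "x \<in> carrier_vec d" "x \<bullet> x = 1"
    using c x by (auto simp: sphere_vec_def)
  show ?thesis
  proof (cases "?h\<^sup>2 = 1")
    case True
    obtain w where w: "w \<in> sphere_vec d" "c \<bullet> w = 0" using ex_unit_orthogonal[OF d c] by blast
    have "?h \<cdot>\<^sub>v c + 0 \<cdot>\<^sub>v w = ?h \<cdot>\<^sub>v c"
      using car w(1) by (intro eq_vecI) (auto simp: sphere_vec_def)
    then have "x = cos (arccos ?h) \<cdot>\<^sub>v c + sin (arccos ?h) \<cdot>\<^sub>v w"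
      using sphere_vec_eq_smult[OF c x True] unfolding trig True by simp
    with w show ?thesis by blast
  next
    case False
    let ?u = "x - ?h \<cdot>\<^sub>v c"
    have uu: "?u \<bullet> ?u = 1 - ?h\<^sup>2"
      using scalar_prod_self_diff_projection(1)[OF c car(2)] car by simp
    have "?h\<^sup>2 \<le> 1" using hb by (simp add: abs_square_le_1 abs_le_iff)
    then have pos: "?u \<bullet> ?u > 0" using uu False by simp
    have u: "?u \<in> carrier_vec d" using car by simp
    let ?w = "(1 / sqrt (?u \<bullet> ?u)) \<cdot>\<^sub>v ?u"
    have w: "?w \<in> sphere_vec d" "c \<bullet> ?w = 0"
      using sphere_vec_normalize_tangent[OF c u scalar_prod_self_diff_projection(2)[OF c car(2)] pos] .
    have "sqrt (?u \<bullet> ?u) \<cdot>\<^sub>v ?w = ?u"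
      using pos by (simp add: smult_smult_assoc)
    moreover have "x = ?h \<cdot>\<^sub>v c + ?u" using car by (intro eq_vecI) auto
    ultimately have "x = cos (arccos ?h) \<cdot>\<^sub>v c + sin (arccos ?h) \<cdot>\<^sub>v ?w"
      unfolding trig uu[symmetric] by (simp only:)
    with w show ?thesis by blast
  qed
qed

lemma great_circle_arc:
  assumes c: "c \<in> sphere_vec d" and w: "w \<in> sphere_vec d" and cw: "c \<bullet> w = 0" and \<alpha>: "\<alpha> \<ge> 0"
  defines "\<gamma> \<equiv> \<lambda>t. cos (\<alpha> * t) \<cdot>\<^sub>v c + sin (\<alpha> * t) \<cdot>\<^sub>v w"
  shows "\<gamma> \<in> sphere_curves d c (cos \<alpha> \<cdot>\<^sub>v c + sin \<alpha> \<cdot>\<^sub>v w)" "curve_length d \<gamma> = \<alpha>"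
proof -
  have car: "c \<in> carrier_vec d" "w \<in> carrier_vec d" "c \<bullet> c = 1" "w \<bullet> w = 1" "w \<bullet> c = 0"
    using c w cw comm_scalar_prod[of c d w] by (auto simp: sphere_vec_def)
  have norm: "(a \<cdot>\<^sub>v c + b \<cdot>\<^sub>v w) \<bullet> (a \<cdot>\<^sub>v c + b \<cdot>\<^sub>v w) = a\<^sup>2 + b\<^sup>2" for a b
    using car cw
    by (simp add: add_scalar_prod_distrib[of _ d] scalar_prod_add_distrib[of _ d] power2_eq_square)
  have comp: "\<gamma> t $ i = cos (\<alpha> * t) * c $ i + sin (\<alpha> * t) * w $ i" if "i < d" for t i
    using that car by (simp add: \<gamma>_def)
  have der: "((\<lambda>s. \<gamma> s $ i) has_real_derivative (- \<alpha> * sin (\<alpha> * t)) * c $ i + \<alpha> * cos (\<alpha> * t) * w $ i) (at t)"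
    if "i < d" for t i
    unfolding comp[OF that] by (auto intro!: derivative_eq_intros)
  have "(\<lambda>t. \<gamma> t $ i) C1_differentiable_on {0..1}" if "i < d" for i
    unfolding C1_differentiable_on_def
  proof (intro exI conjI ballI)
    show "((\<lambda>s. \<gamma> s $ i) has_vector_derivative (- \<alpha> * sin (\<alpha> * t)) * c $ i + \<alpha> * cos (\<alpha> * t) * w $ i) (at t)"
      for t using der[OF that] by (simp add: has_real_derivative_iff_has_vector_derivative)
  qed (intro continuous_intros)
  moreover have "\<gamma> t \<in> sphere_vec d" for t
    using car norm unfolding \<gamma>_def sphere_vec_def by simp
  moreover have "\<gamma> 0 = c" using car by (auto simp: \<gamma>_def intro!: eq_vecI)
  ultimately show "\<gamma> \<in> sphere_curves d c (cos \<alpha> \<cdot>\<^sub>v c + sin \<alpha> \<cdot>\<^sub>v w)"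
    by (simp add: sphere_curves_def \<gamma>_def)
  have "velocity d \<gamma> t = (- \<alpha> * sin (\<alpha> * t)) \<cdot>\<^sub>v c + (\<alpha> * cos (\<alpha> * t)) \<cdot>\<^sub>v w" for t
    using car by (intro eq_vecI) (auto simp: velocity_def DERIV_imp_deriv[OF der])
  then have "vnorm (velocity d \<gamma> t) = sqrt (\<alpha>\<^sup>2 * ((sin (\<alpha> * t))\<^sup>2 + (cos (\<alpha> * t))\<^sup>2))" for t
    unfolding vnorm_def by (simp only: norm) (simp add: power_mult_distrib distrib_left[symmetric])
  then show "curve_length d \<gamma> = \<alpha>"
    using \<alpha> by (simp add: curve_length_def)
qed

lemma sphere_dist_eq_arccos:
  assumes d: "d \<ge> 2" and c: "c \<in> sphere_vec d" and x: "x \<in> sphere_vec d"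
  shows "sphere_dist d c x = arccos (c \<bullet> x)"
proof -
  obtain w where w: "w \<in> sphere_vec d" "c \<bullet> w = 0"
    "x = cos (arccos (c \<bullet> x)) \<cdot>\<^sub>v c + sin (arccos (c \<bullet> x)) \<cdot>\<^sub>v w"
    using sphere_vec_polar[OF d c x] by blast
  have "arccos (c \<bullet> x) \<ge> 0"
    using sphere_vec_scalar_prod_bounds[OF c x] by (rule arccos_lbound)
  from great_circle_arc[OF c w(1,2) this, folded w(3)] obtain \<gamma> where
    \<gamma>: "\<gamma> \<in> sphere_curves d c x" "curve_length d \<gamma> = arccos (c \<bullet> x)" by blast
  show ?thesis
    unfolding sphere_dist_def
    by (rule cInf_eq_minimum)
       (use \<gamma> arccos_le_curve_length[OF c] in \<open>auto simp: image_iff intro: bexI[of _ \<gamma>]\<close>)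
qed

lemma sphere_cball_arccos:
  assumes d: "d \<ge> 2" and c: "c \<in> sphere_vec d" and a: "- 1 \<le> a" "a \<le> 1"
  shows "sphere_cball d c (arccos a) = {x \<in> sphere_vec d. a \<le> c \<bullet> x}"
proof -
  have "sphere_dist d c x \<le> arccos a \<longleftrightarrow> a \<le> c \<bullet> x" if "x \<in> sphere_vec d" for x
    using sphere_dist_eq_arccos[OF d c that] sphere_vec_scalar_prod_bounds[OF c that] a
    by (simp add: arccos_le_mono abs_le_iff)
  then show ?thesis by (auto simp: sphere_cball_def)
qed

section \<open>The leading eigenvector of a symmetric matrix\<close>

text \<open>
  The Householder reflection that exchanges \<open>v\<close> with the first standard basis vector. When the two
  coincide, \<open>u\<close> is zero and \<open>c\<close> is \<open>0\<close> by the convention for division by zero, so that \<open>W\<close> is the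
  identity matrix.
\<close>

lemma ex_reflection_to_first_col:
  fixes v :: "real vec"
  assumes v: "v \<in> carrier_vec n" and vv: "v \<bullet> v = 1" and n: "n > 0"
  obtains W where "W \<in> carrier_mat n n" "W\<^sup>T = W" "W * W = 1\<^sub>m n" "col W 0 = v"
proof -
  define u where "u = v - unit_vec n 0"
  have u: "u \<in> carrier_vec n" using v by (simp add: u_def)
  define c where "c = 2 / (u \<bullet> u)"
  define W where "W = mat n n (\<lambda>(i, j). (if i = j then 1 else 0) - c * u $ i * u $ j)"
  have cuu: "c * c * (u \<bullet> u) = 2 * c"
    by (simp add: c_def)
  have uu: "u \<bullet> u = 2 - 2 * v $ 0"
  proof -
    have "u \<bullet> u = v \<bullet> v - 2 * (v \<bullet> unit_vec n 0) + unit_vec n 0 \<bullet> unit_vec n 0"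
      using v n comm_scalar_prod[OF v, of "unit_vec n 0"] unfolding u_def
      by (simp add: minus_scalar_prod_distrib[of _ n] scalar_prod_minus_distrib[of _ n])
    then show ?thesis using v vv n by simp
  qed
  have W: "W \<in> carrier_mat n n" by (simp add: W_def)
  moreover have "W\<^sup>T = W"
    by (rule eq_matI) (auto simp: W_def)
  moreover have "W * W = 1\<^sub>m n"
  proof (rule eq_matI)
    fix i j assume "i < dim_row (1\<^sub>m n :: real mat)" "j < dim_col (1\<^sub>m n :: real mat)"
    then have ij: "i < n" "j < n" by auto
    have "(W * W) $$ (i, j) = (\<Sum>k<n. W $$ (i, k) * W $$ (k, j))"
      using W ij by (simp add: scalar_prod_def lessThan_atLeast0)
    also have "\<dots> = (\<Sum>k<n. (if k = i then (if i = j then 1 else 0) - c * u $ i * u $ j else 0)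
        - (if k = j then c * u $ i * u $ j else 0) + c * c * u $ i * u $ j * (u $ k * u $ k))"
      using ij by (intro sum.cong) (auto simp: W_def algebra_simps)
    also have "\<dots> = (if i = j then 1 else 0) - 2 * c * u $ i * u $ j
        + c * c * u $ i * u $ j * (\<Sum>k<n. u $ k * u $ k)"
      using ij by (simp add: sum.distrib sum_subtractf sum_distrib_left)
    also have "(\<Sum>k<n. u $ k * u $ k) = u \<bullet> u"
      using u by (simp add: scalar_prod_def lessThan_atLeast0)
    also have "c * c * u $ i * u $ j * (u \<bullet> u) = (c * c * (u \<bullet> u)) * u $ i * u $ j"
      by (simp add: mult_ac)
    finally show "(W * W) $$ (i, j) = 1\<^sub>m n $$ (i, j)"
      using ij by (simp add: cuu)
  qed (use W in auto)
  moreover have "col W 0 = v"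
  proof (rule eq_vecI)
    fix i assume "i < dim_vec v"
    then have i: "i < n" using v by simp
    have u0: "u $ 0 = v $ 0 - 1" using v n by (simp add: u_def)
    have ui: "u $ i = v $ i - (if i = 0 then 1 else 0)" using v n i by (simp add: u_def)
    show "col W 0 $ i = v $ i"
    proof (cases "u \<bullet> u = 0")
      case True
      then have "u = 0\<^sub>v n" using conjugate_square_eq_0_vec[OF u] by simp
      then have "u $ i = 0" using i by simp
      then show ?thesis using ui i n by (auto simp: W_def)
    next
      case False
      then have "c * (v $ 0 - 1) = - 1" unfolding c_def uu by (simp add: field_simps)
      then have "u $ i * (c * u $ 0) = u $ i * (- 1)" unfolding u0 by simp
      then have "c * u $ i * u $ 0 = - u $ i" by (simp add: mult_ac)
      then show ?thesis using ui i n by (auto simp: W_def)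
    qed
  qed (use v in \<open>simp add: W_def\<close>)
  ultimately show ?thesis by (rule that)
qed

text \<open>
  Deflation: if \<open>e\<close> is a root of the characteristic polynomial of a symmetric matrix \<open>A\<close>, then in an
  orthonormal basis that starts with a unit eigenvector \<open>v\<close> for \<open>e\<close> the matrix is block diagonal
  with blocks \<open>e\<close> and \<open>B\<close>, and \<open>B\<close> accounts for the remaining factor \<open>q\<close>. The vector \<open>y\<close> holds
  the coordinates of \<open>x\<close> orthogonal to \<open>v\<close>.
\<close>

lemma symmetric_deflation:
  fixes A :: "real mat"
  assumes A: "A \<in> carrier_mat (Suc m) (Suc m)" and sym: "A\<^sup>T = A"
    and cp: "char_poly A = [:- e, 1:] * q"
  obtains v B where "v \<in> carrier_vec (Suc m)" "v \<bullet> v = 1" "A *\<^sub>v v = e \<cdot>\<^sub>v v"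
    "B \<in> carrier_mat m m" "B\<^sup>T = B" "char_poly B = q"
    "\<And>x. x \<in> carrier_vec (Suc m) \<Longrightarrow> \<exists>y\<in>carrier_vec m.
       x \<bullet> x = (x \<bullet> v)\<^sup>2 + y \<bullet> y \<and> x \<bullet> (A *\<^sub>v x) = e * (x \<bullet> v)\<^sup>2 + y \<bullet> (B *\<^sub>v y)"
proof -
  let ?n = "Suc m"
  have "eigenvalue A e"
    unfolding eigenvalue_root_char_poly[OF A] cp by simp
  then obtain w where w: "w \<in> carrier_vec ?n" "w \<noteq> 0\<^sub>v ?n" "A *\<^sub>v w = e \<cdot>\<^sub>v w"
    using A unfolding eigenvalue_def eigenvector_def by auto
  define v where "v = (1 / sqrt (w \<bullet> w)) \<cdot>\<^sub>v w"
  have v: "v \<in> carrier_vec ?n" using w by (simp add: v_def)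
  have ww: "w \<bullet> w > 0" using conjugate_square_greater_0_vec[OF w(1)] w(2) by simp
  have vv: "v \<bullet> v = 1"
    using w(1) ww by (simp add: v_def)
  have Av: "A *\<^sub>v v = e \<cdot>\<^sub>v v"
    using A w by (simp add: v_def mult_mat_vec[of A ?n ?n] smult_smult_assoc mult.commute)
  obtain W where W: "W \<in> carrier_mat ?n ?n" "W\<^sup>T = W" "W * W = 1\<^sub>m ?n" "col W 0 = v"
    using ex_reflection_to_first_col[OF v vv] by auto
  define D where "D = W * A * W"
  have D: "D \<in> carrier_mat ?n ?n" using W A by (simp add: D_def)
  have symD: "D\<^sup>T = D"
    using W A sym unfolding D_def
    by (simp add: transpose_mult[of _ ?n ?n _ ?n] assoc_mult_mat[of _ ?n ?n _ ?n _ ?n])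
  have Wv: "W *\<^sub>v v = unit_vec ?n 0"
  proof -
    have "W *\<^sub>v v = col (W * W) 0" using W by (metis col_mult2 zero_less_Suc)
    then show ?thesis using W by simp
  qed
  have col0: "col D 0 = e \<cdot>\<^sub>v unit_vec ?n 0"
  proof -
    have "col D 0 = (W * A) *\<^sub>v v"
      unfolding D_def using W A by (subst col_mult2[of _ ?n ?n _ ?n]) auto
    also have "\<dots> = e \<cdot>\<^sub>v (W *\<^sub>v v)"
      using W A v Av by (simp add: assoc_mult_mat_vec[of _ ?n ?n _ ?n] mult_mat_vec[of W ?n ?n])
    finally show ?thesis by (simp add: Wv)
  qed
  have D0: "D $$ (i, 0) = (if i = 0 then e else 0)" if "i < ?n" for i
    using arg_cong[OF col0, of "\<lambda>x. x $ i"] that D by auto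
  have D0': "D $$ (0, i) = (if i = 0 then e else 0)" if "i < ?n" for i
    using D0[OF that] arg_cong[OF symD, of "\<lambda>X. X $$ (i, 0)"] that D by auto
  define B where "B = mat m m (\<lambda>(i, j). D $$ (Suc i, Suc j))"
  have B: "B \<in> carrier_mat m m" by (simp add: B_def)
  have symB: "B\<^sup>T = B"
  proof (rule eq_matI)
    fix i j assume "i < dim_row B" "j < dim_col B"
    then show "B\<^sup>T $$ (i, j) = B $$ (i, j)"
      using arg_cong[OF symD, of "\<lambda>X. X $$ (Suc i, Suc j)"] D by (auto simp: B_def)
  qed (auto simp: B_def)
  define E where "E = mat 1 1 (\<lambda>_. e)"
  have E: "E \<in> carrier_mat 1 1" by (simp add: E_def)
  have D_block: "D = four_block_mat E (0\<^sub>m 1 m) (0\<^sub>m m 1) B"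
    using D D0 D0' by (intro eq_matI) (auto simp: B_def E_def)
  have "similar_mat D A"
    by (rule similar_matI[of _ _ W W ?n]) (use D A W in \<open>auto simp: D_def\<close>)
  then have "char_poly A = char_poly D" using char_poly_similar by metis
  also have "\<dots> = char_poly E * char_poly B"
    unfolding D_block by (rule char_poly_four_block_zeros_col[OF E _ B]) simp
  also have "char_poly E = [:- e, 1:]"
    by (simp add: E_def char_poly_defs det_def sign_def)
  finally have cpB: "char_poly B = q"
    unfolding cp by (metis mult_cancel_left pCons_eq_0_iff zero_neq_one)
  have dec: "\<exists>y\<in>carrier_vec m. x \<bullet> x = (x \<bullet> v)\<^sup>2 + y \<bullet> y \<and>
      x \<bullet> (A *\<^sub>v x) = e * (x \<bullet> v)\<^sup>2 + y \<bullet> (B *\<^sub>v y)" if x: "x \<in> carrier_vec ?n" for x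
  proof -
    define z where "z = W *\<^sub>v x"
    define y where "y = vec m (\<lambda>i. z $ Suc i)"
    have z: "z \<in> carrier_vec ?n" using W x by (simp add: z_def)
    have y: "y \<in> carrier_vec m" by (simp add: y_def)
    have adj: "(W *\<^sub>v a) \<bullet> b = a \<bullet> (W *\<^sub>v b)" if "a \<in> carrier_vec ?n" "b \<in> carrier_vec ?n" for a b
      using transpose_vec_mult_scalar[OF W(1), of b a] that W by simp
    have WWx: "W *\<^sub>v z = x"
      using W x by (simp add: z_def assoc_mult_mat_vec[symmetric, of _ ?n ?n _ ?n])
    have z0: "z $ 0 = x \<bullet> v"
    proof -
      have "z $ 0 = row W 0 \<bullet> x" using W by (simp add: z_def)
      also have "row W 0 = v" using W by (metis carrier_matD(1) row_transpose col_transpose zero_less_Suc)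
      finally show ?thesis using comm_scalar_prod[OF v x] by simp
    qed
    have split: "a \<bullet> b = a $ 0 * b $ 0 + vec m (\<lambda>i. a $ Suc i) \<bullet> vec m (\<lambda>i. b $ Suc i)"
      if "b \<in> carrier_vec ?n" for a b :: "real vec"
      using that by (simp add: scalar_prod_def sum.atLeast0_lessThan_Suc_shift del: sum.op_ivl_Suc)
    have "x \<bullet> x = z \<bullet> z" using adj[OF x z] WWx x z by (simp add: z_def)
    also have "\<dots> = (x \<bullet> v)\<^sup>2 + y \<bullet> y"
      using split[OF z, of z] z0 by (simp add: y_def power2_eq_square)
    finally have 1: "x \<bullet> x = (x \<bullet> v)\<^sup>2 + y \<bullet> y" .
    have "x \<bullet> (A *\<^sub>v x) = (W *\<^sub>v z) \<bullet> (A *\<^sub>v (W *\<^sub>v z))" by (simp add: WWx)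
    also have "\<dots> = z \<bullet> (D *\<^sub>v z)"
      using adj z W A by (simp add: D_def assoc_mult_mat_vec[of _ ?n ?n _ ?n])
    also have "\<dots> = z $ 0 * (D *\<^sub>v z) $ 0 + y \<bullet> vec m (\<lambda>i. (D *\<^sub>v z) $ Suc i)"
      using D z by (subst split) (auto simp: y_def)
    also have "(D *\<^sub>v z) $ 0 = e * z $ 0"
      using D z D0' by (simp add: scalar_prod_def sum.atLeast0_lessThan_Suc_shift del: sum.op_ivl_Suc)
    also have "vec m (\<lambda>i. (D *\<^sub>v z) $ Suc i) = B *\<^sub>v y"
      using D z D0 by (intro eq_vecI)
        (auto simp: B_def y_def scalar_prod_def sum.atLeast0_lessThan_Suc_shift simp del: sum.op_ivl_Suc)
    finally show ?thesis using 1 y z0 by (auto simp: power2_eq_square)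
  qed
  show ?thesis by (rule that[OF v vv Av B symB cpB dec])
qed

lemma quadratic_form_le_eigenvalue_bound:
  fixes A :: "real mat"
  assumes "A \<in> carrier_mat n n" "A\<^sup>T = A" "char_poly A = (\<Prod>k<n. [:- l k, 1:])"
    and "\<And>k. k < n \<Longrightarrow> l k \<le> \<mu>" "x \<in> carrier_vec n"
  shows "x \<bullet> (A *\<^sub>v x) \<le> \<mu> * (x \<bullet> x)"
  using assms
proof (induction n arbitrary: A l x)
  case 0
  then show ?case by (simp add: scalar_prod_def)
next
  case (Suc n)
  have "char_poly A = [:- l 0, 1:] * (\<Prod>k<n. [:- l (Suc k), 1:])"
    using Suc.prems(3) by (simp add: prod.lessThan_Suc_shift del: prod.lessThan_Suc)
  from symmetric_deflation[OF Suc.prems(1,2) this] obtain v B where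
    B: "B \<in> carrier_mat n n" "B\<^sup>T = B" "char_poly B = (\<Prod>k<n. [:- l (Suc k), 1:])"
    and dec: "\<And>x. x \<in> carrier_vec (Suc n) \<Longrightarrow> \<exists>y\<in>carrier_vec n.
       x \<bullet> x = (x \<bullet> v)\<^sup>2 + y \<bullet> y \<and> x \<bullet> (A *\<^sub>v x) = l 0 * (x \<bullet> v)\<^sup>2 + y \<bullet> (B *\<^sub>v y)"
    by metis
  obtain y where y: "y \<in> carrier_vec n" "x \<bullet> x = (x \<bullet> v)\<^sup>2 + y \<bullet> y"
    "x \<bullet> (A *\<^sub>v x) = l 0 * (x \<bullet> v)\<^sup>2 + y \<bullet> (B *\<^sub>v y)"
    using dec[OF Suc.prems(5)] by blast
  have "y \<bullet> (B *\<^sub>v y) \<le> \<mu> * (y \<bullet> y)"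
    using Suc.prems(4) by (intro Suc.IH[OF B _ y(1)]) auto
  moreover have "l 0 * (x \<bullet> v)\<^sup>2 \<le> \<mu> * (x \<bullet> v)\<^sup>2"
    using Suc.prems(4)[of 0] by (intro mult_right_mono) auto
  ultimately show ?case by (simp add: y algebra_simps)
qed

lemma ex_leading_eigenvector:
  fixes A :: "real mat"
  assumes d: "d \<ge> 2" and A: "A \<in> carrier_mat d d" and sym: "A\<^sup>T = A"
    and cp: "char_poly A = (\<Prod>k=1..d. [:- lam k, 1:])"
    and ord: "\<forall>j k. 2 \<le> j \<and> j \<le> k \<and> k \<le> d \<longrightarrow> lam j \<ge> lam k"
  obtains v where "v \<in> carrier_vec d" "v \<bullet> v = 1" "A *\<^sub>v v = lam 1 \<cdot>\<^sub>v v"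
    "\<And>x. x \<in> carrier_vec d \<Longrightarrow> x \<bullet> (A *\<^sub>v x) \<le> lam 1 * (x \<bullet> v)\<^sup>2 + lam 2 * (x \<bullet> x - (x \<bullet> v)\<^sup>2)"
proof -
  obtain m where m: "d = Suc m" "m > 0" using d by (cases d) auto
  have "char_poly A = [:- lam 1, 1:] * (\<Prod>k<m. [:- lam (k + 2), 1:])"
  proof -
    have "char_poly A = (\<Prod>k<Suc m. [:- lam (Suc k), 1:])"
      using cp unfolding m One_nat_def prod.atLeast1_atMost_eq .
    then show ?thesis
      by (simp only: prod.lessThan_Suc_shift) (simp add: numeral_2_eq_2)
  qed
  from symmetric_deflation[OF A[unfolded m] sym this] obtain v B where
    v: "v \<in> carrier_vec d" "v \<bullet> v = 1" "A *\<^sub>v v = lam 1 \<cdot>\<^sub>v v"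
    and B: "B \<in> carrier_mat m m" "B\<^sup>T = B" "char_poly B = (\<Prod>k<m. [:- lam (k + 2), 1:])"
    and dec: "\<And>x. x \<in> carrier_vec (Suc m) \<Longrightarrow> \<exists>y\<in>carrier_vec m.
       x \<bullet> x = (x \<bullet> v)\<^sup>2 + y \<bullet> y \<and> x \<bullet> (A *\<^sub>v x) = lam 1 * (x \<bullet> v)\<^sup>2 + y \<bullet> (B *\<^sub>v y)"
    unfolding m by metis
  show ?thesis
  proof (rule that[OF v])
    fix x :: "real vec" assume x: "x \<in> carrier_vec d"
    then obtain y where y: "y \<in> carrier_vec m" "x \<bullet> x = (x \<bullet> v)\<^sup>2 + y \<bullet> y"
      "x \<bullet> (A *\<^sub>v x) = lam 1 * (x \<bullet> v)\<^sup>2 + y \<bullet> (B *\<^sub>v y)"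
      using dec m by blast
    have "y \<bullet> (B *\<^sub>v y) \<le> lam 2 * (y \<bullet> y)"
      by (rule quadratic_form_le_eigenvalue_bound[OF B _ y(1)]) (use ord m in auto)
    then show "x \<bullet> (A *\<^sub>v x) \<le> lam 1 * (x \<bullet> v)\<^sup>2 + lam 2 * (x \<bullet> x - (x \<bullet> v)\<^sup>2)"
      by (simp add: y)
  qed
qed

section \<open>Gradient domination near the minimizers\<close>

lemma projection_mult_vec:
  assumes x: "x \<in> carrier_vec d" and y: "y \<in> carrier_vec d"
  shows "(1\<^sub>m d - outer_prod x x) *\<^sub>v y = y - (x \<bullet> y) \<cdot>\<^sub>v x"
proof (rule eq_vecI)
  fix i assume "i < dim_vec (y - (x \<bullet> y) \<cdot>\<^sub>v x)"
  then have i: "i < d" using x by simp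
  have "((1\<^sub>m d - outer_prod x x) *\<^sub>v y) $ i
      = (\<Sum>j<d. (if j = i then y $ i else 0) - x $ i * (x $ j * y $ j))"
    using x y i
    by (simp add: scalar_prod_sum_lessThan[OF y] outer_prod_def)
       (auto intro!: sum.cong simp: left_diff_distrib)
  also have "\<dots> = y $ i - x $ i * (x \<bullet> y)"
    using i by (simp add: sum_subtractf sum_distrib_left scalar_prod_sum_lessThan[OF y])
  finally show "((1\<^sub>m d - outer_prod x x) *\<^sub>v y) $ i = (y - (x \<bullet> y) \<cdot>\<^sub>v x) $ i"
    using x y i by (simp add: mult.commute)
qed (use x in \<open>auto simp: outer_prod_def\<close>)

text \<open>
  A symmetric matrix with a unit eigenvector \<open>v\<close> for \<open>\<kappa>\<close>, whose quadratic form has the upper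
  bound \<open>\<mu> < \<kappa>\<close> on the unit vectors orthogonal to \<open>v\<close>. The bound is stated on all vectors, through
  their components along \<open>v\<close> and orthogonal to it.
\<close>

locale leading_eigenvector =
  fixes d :: nat and A :: "real mat" and v :: "real vec" and \<kappa> \<mu> :: real
  assumes A: "A \<in> carrier_mat d d" and sym: "A\<^sup>T = A"
    and v: "v \<in> sphere_vec d" and Av: "A *\<^sub>v v = \<kappa> \<cdot>\<^sub>v v" and gap: "\<mu> < \<kappa>"
    and quad_le: "\<And>x. x \<in> carrier_vec d \<Longrightarrow>
      x \<bullet> (A *\<^sub>v x) \<le> \<kappa> * (x \<bullet> v)\<^sup>2 + \<mu> * (x \<bullet> x - (x \<bullet> v)\<^sup>2)"
begin

text \<open>
  The excess of \<open>f\<close> over its minimum dominates the squared sine of the angle to \<open>v\<close>.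
\<close>

lemma excess_ge:
  assumes x: "x \<in> sphere_vec d"
  shows "(\<kappa> - \<mu>) * (1 - (v \<bullet> x)\<^sup>2) \<le> neg_quad_form A x + \<kappa>"
  using quad_le[of x] x v comm_scalar_prod[of x d v]
  by (simp add: sphere_vec_def neg_quad_form_def algebra_simps)

lemma neg_quad_form_ge:
  assumes x: "x \<in> sphere_vec d"
  shows "- \<kappa> \<le> neg_quad_form A x"
proof -
  have "(v \<bullet> x)\<^sup>2 \<le> 1"
    using sphere_vec_scalar_prod_bounds[OF v x] by (simp add: abs_square_le_1 abs_le_iff)
  then have "0 \<le> (\<kappa> - \<mu>) * (1 - (v \<bullet> x)\<^sup>2)" using gap by simp
  then show ?thesis using excess_ge[OF x] by simp
qed

lemma neg_quad_form_leading: "neg_quad_form A v = - \<kappa>"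
  using v by (simp add: neg_quad_form_def Av sphere_vec_def)

lemma Inf_neg_quad_form: "(INF y\<in>sphere_vec d. neg_quad_form A y) = - \<kappa>"
  by (rule cInf_eq_minimum)
     (use v neg_quad_form_leading neg_quad_form_ge in \<open>auto simp: image_iff intro!: bexI[of _ v]\<close>)

lemma is_arg_min_iff:
  "is_arg_min (neg_quad_form A) (\<lambda>y. y \<in> sphere_vec d) m \<longleftrightarrow> m = v \<or> m = (- 1) \<cdot>\<^sub>v v"
proof
  assume "is_arg_min (neg_quad_form A) (\<lambda>y. y \<in> sphere_vec d) m"
  then have m: "m \<in> sphere_vec d" "neg_quad_form A m \<le> - \<kappa>"
    using v neg_quad_form_leading by (force simp: is_arg_min_def not_less)+
  have "(\<kappa> - \<mu>) * (1 - (v \<bullet> m)\<^sup>2) \<le> 0" using excess_ge[OF m(1)] m(2) by simp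
  then have "1 \<le> (v \<bullet> m)\<^sup>2" using gap by (simp add: mult_le_0_iff)
  moreover have "(v \<bullet> m)\<^sup>2 \<le> 1"
    using sphere_vec_scalar_prod_bounds[OF v m(1)] by (simp add: abs_square_le_1 abs_le_iff)
  ultimately have sq: "(v \<bullet> m)\<^sup>2 = 1" by simp
  then have "v \<bullet> m = 1 \<or> v \<bullet> m = - 1" by (simp add: power2_eq_1_iff)
  with sphere_vec_eq_smult[OF v m(1) sq] show "m = v \<or> m = (- 1) \<cdot>\<^sub>v v"
    by (metis one_smult_vec)
next
  assume m: "m = v \<or> m = (- 1) \<cdot>\<^sub>v v"
  have vv: "v \<in> carrier_vec d" "v \<bullet> v = 1" using v by (auto simp: sphere_vec_def)
  have "neg_quad_form A ((- 1) \<cdot>\<^sub>v v) = - \<kappa>"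
    using A vv by (simp add: neg_quad_form_def mult_mat_vec[of A d d] Av)
  moreover have "(- 1) \<cdot>\<^sub>v v \<in> sphere_vec d" using vv by (simp add: sphere_vec_def)
  ultimately have "m \<in> sphere_vec d \<and> neg_quad_form A m = - \<kappa>"
    using m v neg_quad_form_leading by auto
  then show "is_arg_min (neg_quad_form A) (\<lambda>y. y \<in> sphere_vec d) m"
    using neg_quad_form_ge by (auto simp: is_arg_min_def not_less)
qed

text \<open>
  Cauchy-Schwarz for the gradient \<open>G\<close> and the tangential part \<open>w\<close> of \<open>v\<close> at \<open>x\<close>, combined with
  \<open>excess_ge\<close>.
\<close>

lemma excess_le_gradient:
  assumes x: "x \<in> sphere_vec d"
  shows "4 * (\<kappa> - \<mu>) * (v \<bullet> x)\<^sup>2 * (neg_quad_form A x + \<kappa>)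
           \<le> (vnorm (sphere_grad d (neg_quad_form A) x))\<^sup>2"
proof -
  let ?s = "v \<bullet> x"
  define g where "g = neg_quad_form A x + \<kappa>"
  define y where "y = (- 2) \<cdot>\<^sub>v (A *\<^sub>v x)"
  define G where "G = sphere_grad d (neg_quad_form A) x"
  define w where "w = v - (x \<bullet> v) \<cdot>\<^sub>v x"
  have xx: "x \<in> carrier_vec d" "x \<bullet> x = 1" and vv: "v \<in> carrier_vec d" "v \<bullet> v = 1"
    using x v by (auto simp: sphere_vec_def)
  have Ax: "A *\<^sub>v x \<in> carrier_vec d" and y: "y \<in> carrier_vec d" using A xx by (auto simp: y_def)
  have G: "G = y - (x \<bullet> y) \<cdot>\<^sub>v x"
    unfolding G_def sphere_grad_neg_quad_form[OF A sym xx(1)] y_def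
    by (rule projection_mult_vec) (use xx Ax in auto)
  have xv: "x \<bullet> v = ?s" using comm_scalar_prod[OF xx(1) vv(1)] .
  have xy: "x \<bullet> y = - 2 * (\<kappa> - g)"
    using xx Ax by (simp add: y_def g_def neg_quad_form_def)
  have yv: "y \<bullet> v = - 2 * (\<kappa> * ?s)"
  proof -
    have "(A *\<^sub>v x) \<bullet> v = v \<bullet> (A *\<^sub>v x)" by (rule comm_scalar_prod[OF Ax vv(1)])
    also have "\<dots> = (A *\<^sub>v v) \<bullet> x"
      using transpose_vec_mult_scalar[OF A xx(1) vv(1)] sym by simp
    also have "\<dots> = \<kappa> * ?s" using xx vv by (simp add: Av)
    finally show ?thesis using Ax vv by (simp add: y_def)
  qed
  have w: "w \<in> carrier_vec d" using xx vv by (simp add: w_def)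
  have Gc: "G \<in> carrier_vec d" using y xx by (simp add: G)
  have Gw: "G \<bullet> w = - 2 * g * ?s"
  proof -
    have "G \<bullet> w = y \<bullet> v - (x \<bullet> y) * (x \<bullet> v)"
      using y xx vv comm_scalar_prod[OF y xx(1)] unfolding G w_def
      by (simp add: minus_scalar_prod_distrib[of _ d] scalar_prod_minus_distrib[of _ d])
    then show ?thesis by (simp add: xy yv xv algebra_simps)
  qed
  have ww: "w \<bullet> w = 1 - ?s\<^sup>2"
    using scalar_prod_self_diff_projection(1)[OF x vv(1)] vv xv by (simp add: w_def)
  have "(2 * g * ?s)\<^sup>2 \<le> (G \<bullet> G) * (1 - ?s\<^sup>2)"
    using scalar_prod_Cauchy_Schwarz[OF Gc w] by (simp add: Gw ww)
  then have "(\<kappa> - \<mu>) * (4 * g\<^sup>2 * ?s\<^sup>2) \<le> (\<kappa> - \<mu>) * ((G \<bullet> G) * (1 - ?s\<^sup>2))"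
    using gap by (intro mult_left_mono) (auto simp: power_mult_distrib)
  also have "\<dots> = (G \<bullet> G) * ((\<kappa> - \<mu>) * (1 - ?s\<^sup>2))" by simp
  also have "\<dots> \<le> (G \<bullet> G) * g"
    using excess_ge[OF x] by (intro mult_left_mono) (auto simp: g_def scalar_prod_def sum_nonneg)
  finally have *: "(4 * (\<kappa> - \<mu>) * ?s\<^sup>2 * g) * g \<le> (G \<bullet> G) * g"
    by (simp add: power2_eq_square algebra_simps)
  have GG: "(vnorm G)\<^sup>2 = G \<bullet> G"
    by (simp add: vnorm_def scalar_prod_def sum_nonneg)
  have "g \<ge> 0" using neg_quad_form_ge[OF x] by (simp add: g_def)
  \<comment> \<open>One factor \<open>g\<close> is to be cancelled from both sides.\<close>
  then consider "g = 0" | "g > 0" by linarith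
  then have "4 * (\<kappa> - \<mu>) * ?s\<^sup>2 * g \<le> G \<bullet> G"
  proof cases
    case 1
    then show ?thesis by (simp add: GG[symmetric])
  next
    case 2
    with * show ?thesis by (simp only: mult_le_cancel_right_pos)
  qed
  then show ?thesis by (simp only: GG[symmetric]) (simp only: g_def G_def)
qed

lemma gradient_dominated_on_cap:
  assumes m: "m = v \<or> m = (- 1) \<cdot>\<^sub>v v" and a: "a > 0"
  shows "gradient_dominated_on d (neg_quad_form A) (1 / (4 * (\<kappa> - \<mu>) * a\<^sup>2))
           {x \<in> sphere_vec d. a \<le> m \<bullet> x}"
  unfolding gradient_dominated_on_def Inf_neg_quad_form
proof
  fix x assume "x \<in> {x \<in> sphere_vec d. a \<le> m \<bullet> x}"
  then have x: "x \<in> sphere_vec d" "a \<le> m \<bullet> x" by auto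
  have "(m \<bullet> x)\<^sup>2 = (v \<bullet> x)\<^sup>2" using m x v by (auto simp: sphere_vec_def)
  then have "a\<^sup>2 \<le> (v \<bullet> x)\<^sup>2" using x(2) a by (metis power_mono less_imp_le)
  moreover have "neg_quad_form A x + \<kappa> \<ge> 0" using neg_quad_form_ge[OF x(1)] by simp
  ultimately have "4 * (\<kappa> - \<mu>) * a\<^sup>2 * (neg_quad_form A x + \<kappa>)
      \<le> 4 * (\<kappa> - \<mu>) * (v \<bullet> x)\<^sup>2 * (neg_quad_form A x + \<kappa>)"
    using gap by (intro mult_right_mono mult_left_mono) auto
  also note excess_le_gradient[OF x(1)]
  finally show "neg_quad_form A x - - \<kappa>
      \<le> 1 / (4 * (\<kappa> - \<mu>) * a\<^sup>2) * (vnorm (sphere_grad d (neg_quad_form A) x))\<^sup>2"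
    using gap a by (simp add: field_simps)
qed

end

section \<open>The volume of a slab of the unit ball\<close>

text \<open>
  Change of variables for a dilation followed by a translation in a finite power of the real line;
  it holds because it holds on boxes.
\<close>

lemma emeasure_lborel_PiM_affine:
  fixes t :: "'i \<Rightarrow> real" and c :: real
  assumes I: "finite I" and c: "c > 0" and S: "S \<in> sets (\<Pi>\<^sub>M i\<in>I. lborel)"
  shows "emeasure (\<Pi>\<^sub>M i\<in>I. lborel) S = ennreal (c ^ card I) *
           emeasure (\<Pi>\<^sub>M i\<in>I. lborel) ((\<lambda>x. \<lambda>i\<in>I. t i + c * x i) -` S \<inter> space (\<Pi>\<^sub>M i\<in>I. lborel))"
proof -
  interpret product_sigma_finite "\<lambda>_::'i. lborel :: real measure" ..
  let ?M = "\<Pi>\<^sub>M i\<in>I. (lborel :: real measure)"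
  let ?T = "\<lambda>x. \<lambda>i\<in>I. t i + c * x i"
  have T [measurable]: "?T \<in> measurable ?M ?M"
    by measurable
  have "scale_measure (ennreal (c ^ card I)) (distr ?M ?M ?T) = ?M"
  proof (rule PiM_eqI)
    fix A :: "'i \<Rightarrow> real set"
    assume A: "\<And>i. i \<in> I \<Longrightarrow> A i \<in> sets lborel"
    have pre: "?T -` Pi\<^sub>E I A \<inter> space ?M = Pi\<^sub>E I (\<lambda>i. (\<lambda>u. t i + c * u) -` A i)"
      by (auto simp: space_PiM PiE_iff extensional_def)
    have A': "(\<lambda>u. t i + c * u) -` A i \<in> sets lborel" if "i \<in> I" for i
      using measurable_sets[of "\<lambda>u. t i + c * u" borel borel "A i"] A[OF that] by simp
    have one: "emeasure lborel (A i) = ennreal c * emeasure lborel ((\<lambda>u. t i + c * u) -` A i)"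
      if "i \<in> I" for i
      using A[OF that] c
      by (subst lborel_real_affine[of c "t i"])
         (simp_all add: emeasure_density_const emeasure_distr)
    have "emeasure (scale_measure (ennreal (c ^ card I)) (distr ?M ?M ?T)) (Pi\<^sub>E I A)
        = ennreal (c ^ card I) * (\<Prod>i\<in>I. emeasure lborel ((\<lambda>u. t i + c * u) -` A i))"
      using I A A' by (simp add: emeasure_distr sets_PiM_I_finite pre emeasure_PiM)
    also have "\<dots> = (\<Prod>i\<in>I. emeasure lborel (A i))"
      using c by (simp add: one prod.distrib ennreal_power)
    finally show "emeasure (scale_measure (ennreal (c ^ card I)) (distr ?M ?M ?T)) (Pi\<^sub>E I A)
        = (\<Prod>i\<in>I. emeasure lborel (A i))" .
  qed (use I in simp_all)
  then have "emeasure ?M S = emeasure (scale_measure (ennreal (c ^ card I)) (distr ?M ?M ?T)) S"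
    by simp
  also have "\<dots> = ennreal (c ^ card I) * emeasure ?M (?T -` S \<inter> space ?M)"
    using S by (simp add: emeasure_distr)
  finally show ?thesis .
qed

text \<open>
  The squared norm of \<open>\<theta> y + t v\<close> is at most \<open>\<theta>\<^sup>2 + 2 t \<bar>y \<bullet> v\<bar> + t\<^sup>2\<close>. Here
  \<open>\<theta>\<^sup>2 = exp (-2/d)\<close> is at most \<open>1 - 2 / (d + 2)\<close>, and the other two terms contribute at most
  \<open>1 / (3 d)\<close>.
\<close>

lemma slab_translate_subset_ball:
  fixes y v :: "'i \<Rightarrow> real"
  assumes d: "card I \<ge> 1" and v: "(\<Sum>i\<in>I. (v i)\<^sup>2) = 1"
    and y: "(\<Sum>i\<in>I. (y i)\<^sup>2) \<le> 1"
    and yv: "\<bar>\<Sum>i\<in>I. y i * v i\<bar> \<le> 1 / (12 * sqrt (card I))"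
    and t: "0 \<le> t" "t \<le> 1 / (2 * sqrt (card I))"
    and \<theta>: "\<theta> = exp (- 1 / card I)"
  shows "(\<Sum>i\<in>I. (\<theta> * y i + t * v i)\<^sup>2) \<le> 1"
proof -
  define d where "d = real (card I)"
  have d1: "d \<ge> 1" using d by (simp add: d_def)
  let ?b = "\<Sum>i\<in>I. y i * v i"
  have th: "0 < \<theta>" "\<theta> \<le> 1" using \<theta> by auto
  have "\<theta>\<^sup>2 = 1 / exp (2 / d)"
    unfolding \<theta> by (simp add: exp_double[symmetric] exp_minus field_simps d_def)
  also have "\<dots> \<le> 1 / (1 + 2 / d)"
    using d1 exp_ge_add_one_self[of "2 / d"]
    by (intro divide_left_mono) (auto intro!: mult_pos_pos add_pos_nonneg)
  finally have th2: "\<theta>\<^sup>2 \<le> d / (d + 2)"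
    using d1 by (simp add: field_simps)
  have sd: "sqrt d > 0" "sqrt d * sqrt d = d" using d1 by auto
  have "(\<Sum>i\<in>I. (\<theta> * y i + t * v i)\<^sup>2)
      = \<theta>\<^sup>2 * (\<Sum>i\<in>I. (y i)\<^sup>2) + 2 * (\<theta> * t) * ?b + t\<^sup>2 * (\<Sum>i\<in>I. (v i)\<^sup>2)"
    by (simp add: power2_eq_square algebra_simps sum.distrib sum_distrib_left)
  also have "\<dots> \<le> \<theta>\<^sup>2 + 2 * (t * (1 / (12 * sqrt d))) + t\<^sup>2"
  proof -
    have "\<theta>\<^sup>2 * (\<Sum>i\<in>I. (y i)\<^sup>2) \<le> \<theta>\<^sup>2 * 1" using y by (intro mult_left_mono) auto
    moreover have "(\<theta> * t) * ?b \<le> (\<theta> * t) * \<bar>?b\<bar>"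
      using th t by (intro mult_left_mono) auto
    moreover have "(\<theta> * t) * \<bar>?b\<bar> \<le> t * (1 / (12 * sqrt d))"
      using th t yv by (intro mult_mono) (auto simp: d_def mult_left_le_one_le)
    ultimately show ?thesis using v by simp
  qed
  also have "\<dots> \<le> d / (d + 2) + 2 * (1 / (2 * sqrt d) * (1 / (12 * sqrt d))) + (1 / (2 * sqrt d))\<^sup>2"
    using th2 t sd by (intro add_mono mult_left_mono mult_right_mono power_mono) (auto simp: d_def)
  also have "\<dots> = d / (d + 2) + 1 / (3 * d)"
  proof -
    have "2 * (1 / (2 * sqrt d) * (1 / (12 * sqrt d))) + (1 / (2 * sqrt d))\<^sup>2
        = (1 / 12 + 1 / 4) / (sqrt d * sqrt d)"
      by (simp add: power2_eq_square add_divide_distrib)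
    then show ?thesis using d1 unfolding sd by simp
  qed
  also have "\<dots> \<le> d / (d + 2) + 2 / (d + 2)"
    using d1 by (intro add_left_mono) (simp add: field_simps)
  also have "\<dots> = 1" using d1 by (simp add: add_divide_distrib[symmetric])
  finally show ?thesis .
qed

text \<open>
  The sets \<open>E k\<close> are the translates \<open>\<theta> S + t k v\<close> of the shrunk slab, written as preimages under the
  inverse maps \<open>T k\<close>. The shifts \<open>t k\<close> are multiples of the thickness \<open>2 \<theta> a\<close>, which makes the
  translates disjoint.
\<close>

lemma emeasure_ball_slab_le:
  fixes v :: "'i \<Rightarrow> real" and p :: real
  defines "M \<equiv> \<lambda>I. \<Pi>\<^sub>M i\<in>I. (lborel :: real measure)"
  assumes I: "finite I" and d: "card I \<ge> 1" and v: "(\<Sum>i\<in>I. (v i)\<^sup>2) = 1" and p: "0 < p" "p \<le> 1"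
  shows "emeasure (M I) {x \<in> space (M I). (\<Sum>i\<in>I. (x i)\<^sup>2) \<le> 1 \<and>
             \<bar>\<Sum>i\<in>I. x i * v i\<bar> < p / (12 * sqrt (card I))}
         \<le> ennreal p * emeasure (M I) {x \<in> space (M I). (\<Sum>i\<in>I. (x i)\<^sup>2) \<le> 1}"
proof -
  define a where "a = p / (12 * sqrt (card I))"
  define \<theta> where "\<theta> = exp (- 1 / card I)"
  define N where "N = nat \<lceil>3 / p\<rceil>"
  define t where "t k = 2 * \<theta> * a * real k" for k :: nat
  let ?S = "{x \<in> space (M I). (\<Sum>i\<in>I. (x i)\<^sup>2) \<le> 1 \<and> \<bar>\<Sum>i\<in>I. x i * v i\<bar> < a}"
  let ?B = "{x \<in> space (M I). (\<Sum>i\<in>I. (x i)\<^sup>2) \<le> 1}"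
  define T where "T k x = (\<lambda>i\<in>I. - (t k * v i / \<theta>) + 1 / \<theta> * x i)" for k and x :: "'i \<Rightarrow> real"
  define E where "E k = T k -` ?S \<inter> space (M I)" for k
  have sd: "sqrt (card I) > 0" using d by simp
  have a0: "a > 0" using p sd by (simp add: a_def)
  have th: "0 < \<theta>" "\<theta> \<le> 1" by (auto simp: \<theta>_def)
  have S [measurable]: "?S \<in> sets (M I)"
    unfolding M_def by measurable
  have T [measurable]: "T k \<in> measurable (M I) (M I)" for k
    unfolding M_def T_def by measurable
  have E [measurable]: "E k \<in> sets (M I)" for k
    unfolding E_def by measurable
  have B [measurable]: "?B \<in> sets (M I)"
    unfolding M_def by measurable
  \<comment> \<open>The choice of \<open>\<theta>\<close> makes the volume ratio independent of the dimension.\<close>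
  have "(1 / \<theta>) ^ card I = exp 1"
    using d by (simp add: \<theta>_def exp_minus field_simps exp_of_nat_mult[symmetric])
  then have vol: "emeasure (M I) ?S = ennreal (exp 1) * emeasure (M I) (E k)" for k
    using emeasure_lborel_PiM_affine[OF I, of "1 / \<theta>" ?S "\<lambda>i. - (t k * v i / \<theta>)"] S th
    by (simp add: M_def E_def T_def)
  have Tv: "(\<Sum>i\<in>I. T k x i * v i) = ((\<Sum>i\<in>I. x i * v i) - t k) / \<theta>" for k x
  proof -
    have "(\<Sum>i\<in>I. T k x i * v i) = (\<Sum>i\<in>I. (x i * v i) / \<theta> - t k / \<theta> * (v i)\<^sup>2)"
      using th by (intro sum.cong) (auto simp: T_def field_simps power2_eq_square)
    also have "\<dots> = (\<Sum>i\<in>I. x i * v i) / \<theta> - t k / \<theta>"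
      using v by (simp add: sum_subtractf sum_divide_distrib[symmetric] sum_distrib_left[symmetric])
    finally show ?thesis by (simp add: diff_divide_distrib)
  qed
  have disj: "disjoint_family_on E {..<N}"
  proof -
    have "E j \<inter> E k = {}" if jk: "j < k" for j k
    proof (rule ccontr)
      assume "E j \<inter> E k \<noteq> {}"
      then obtain x where x: "x \<in> E j" "x \<in> E k" by blast
      let ?b = "\<Sum>i\<in>I. x i * v i"
      have "\<bar>?b - t j\<bar> < a * \<theta>" "\<bar>?b - t k\<bar> < a * \<theta>"
        using x th Tv[of j x] Tv[of k x] by (simp_all add: E_def abs_divide divide_less_eq)
      then have "t k - t j < 2 * (a * \<theta>)" by linarith
      moreover have "2 * (a * \<theta>) * 1 \<le> 2 * (a * \<theta>) * (real k - real j)"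
        using jk a0 th by (intro mult_left_mono) auto
      ultimately show False by (simp add: t_def algebra_simps)
    qed
    then show ?thesis
      unfolding disjoint_family_on_def by (metis Int_commute nat_neq_iff)
  qed
  have EB: "E k \<subseteq> ?B" if k: "k < N" for k
  proof
    fix x assume x: "x \<in> E k"
    let ?y = "T k x"
    have y: "?y \<in> ?S" "x \<in> space (M I)" using x by (auto simp: E_def)
    have "real k \<le> 3 / p"
      using k p unfolding N_def by linarith
    then have "2 * \<theta> * a * real k \<le> 2 * 1 * a * (3 / p)"
      using th a0 by (intro mult_mono) auto
    also have "\<dots> = 1 / (2 * sqrt (card I))"
      using p by (simp add: a_def)
    finally have tk: "t k \<le> 1 / (2 * sqrt (card I))" by (simp add: t_def)
    have "a \<le> 1 / (12 * sqrt (card I))"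
      using p sd unfolding a_def by (intro divide_right_mono) auto
    then have "(\<Sum>i\<in>I. (\<theta> * ?y i + t k * v i)\<^sup>2) \<le> 1"
      using y(1) a0 th by (intro slab_translate_subset_ball[OF d v _ _ _ tk \<theta>_def]) (auto simp: t_def)
    moreover have "\<theta> * ?y i + t k * v i = x i" if "i \<in> I" for i
      using that th by (simp add: T_def field_simps)
    ultimately show "x \<in> ?B" using y(2) by simp
  qed
  have "of_nat N * emeasure (M I) ?S = (\<Sum>k<N. ennreal (exp 1) * emeasure (M I) (E k))"
    using vol by simp
  also have "\<dots> = ennreal (exp 1) * emeasure (M I) (\<Union>k<N. E k)"
    using disj by (subst sum_emeasure[symmetric]) (auto simp: sum_distrib_left)
  also have "\<dots> \<le> ennreal 3 * emeasure (M I) ?B"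
    using EB exp_le by (intro mult_mono emeasure_mono ennreal_leI) auto
  finally have main: "of_nat N * emeasure (M I) ?S \<le> ennreal 3 * emeasure (M I) ?B" .
  have "ennreal (p / 3) * of_nat N \<ge> 1"
  proof -
    have "real N \<ge> 3 / p" unfolding N_def using p by linarith
    then have "p / 3 * real N \<ge> 1" using p by (simp add: field_simps)
    then have "1 \<le> ennreal (p / 3 * real N)" by simp
    also have "\<dots> = ennreal (p / 3) * of_nat N"
      using p by (subst ennreal_mult) (auto simp: ennreal_of_nat_eq_real_of_nat)
    finally show ?thesis .
  qed
  then have "1 * emeasure (M I) ?S \<le> (ennreal (p / 3) * of_nat N) * emeasure (M I) ?S"
    by (intro mult_right_mono) auto
  also have "\<dots> \<le> ennreal (p / 3) * (ennreal 3 * emeasure (M I) ?B)"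
    using main by (simp add: mult.assoc mult_left_mono)
  also have "\<dots> = ennreal (p / 3 * 3) * emeasure (M I) ?B"
    using p by (subst ennreal_mult) (auto simp: mult.assoc)
  finally show ?thesis by (simp add: a_def)
qed

section \<open>The uniform distribution on the sphere\<close>

lemma space_borel_vec: "space (borel_vec d) = carrier_vec d"
  by (simp add: borel_vec_def)

lemma vec_index_borel_vec [measurable]:
  assumes "i < d"
  shows "(\<lambda>x. x $ i) \<in> borel_measurable (borel_vec d)"
proof -
  have "(\<lambda>x. \<lambda>i\<in>{..<d}. x $ i) \<in> measurable (borel_vec d) (\<Pi>\<^sub>M i\<in>{..<d}. (borel :: real measure))"
    unfolding borel_vec_def by (rule measurable_vimage_algebra1) (auto simp: space_PiM)
  from measurable_compose[OF this measurable_component_singleton, of i] assms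
  show ?thesis by simp
qed

lemma measurable_borel_vecI:
  assumes "\<And>x. x \<in> space N \<Longrightarrow> g x \<in> carrier_vec d"
    and "\<And>i. i < d \<Longrightarrow> (\<lambda>x. g x $ i) \<in> borel_measurable N"
  shows "g \<in> measurable N (borel_vec d)"
  unfolding borel_vec_def
  by (rule measurable_vimage_algebra2) (use assms in \<open>auto intro!: measurable_restrict\<close>)

lemma scalar_prod_borel_vec:
  assumes y: "y \<in> carrier_vec d"
  shows "(\<lambda>x. x \<bullet> y) \<in> borel_measurable (borel_vec d)"
  unfolding scalar_prod_sum_lessThan[OF y] by measurable

lemma vnorm_borel_vec: "vnorm \<in> borel_measurable (borel_vec d)"
proof -
  have "(\<lambda>x. sqrt (\<Sum>i<d. x $ i * x $ i)) \<in> borel_measurable (borel_vec d)"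
    by measurable
  also have "?this \<longleftrightarrow> ?thesis"
    by (intro measurable_cong) (simp add: space_borel_vec vnorm_def scalar_prod_sum_lessThan)
  finally show ?thesis .
qed

lemma vec_measurable_borel_vec:
  "vec d \<in> measurable (\<Pi>\<^sub>M i\<in>{..<d}. (lborel :: real measure)) (borel_vec d)"
proof (rule measurable_borel_vecI)
  fix i assume i: "i < d"
  then have "(\<lambda>x. x i) \<in> borel_measurable (\<Pi>\<^sub>M i\<in>{..<d}. (lborel :: real measure))"
    using measurable_component_singleton[of i "{..<d}" "\<lambda>_. lborel :: real measure"] by simp
  then show "(\<lambda>x. vec d x $ i) \<in> borel_measurable (\<Pi>\<^sub>M i\<in>{..<d}. (lborel :: real measure))"
    using i by simp
qed simp

text \<open>
  The uniform distribution is the law of \<open>y / \<parallel>y\<parallel>\<close> for \<open>y\<close> uniform in the unit ball. If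
  \<open>y / \<parallel>y\<parallel>\<close> misses the caps, then \<open>\<bar>y \<bullet> v\<bar> < a \<parallel>y\<parallel> \<le> a\<close>, so \<open>y\<close> lies in the slab; the origin,
  whose normalization is not on the sphere, lies in the slab as well.
\<close>

lemma measure_uniform_sphere_caps_ge:
  assumes d: "d \<ge> 1" and v: "v \<in> sphere_vec d" and p: "0 < p" "p \<le> 1"
  shows "measure (uniform_sphere d) {x \<in> sphere_vec d. p / (12 * sqrt d) \<le> \<bar>x \<bullet> v\<bar>} \<ge> 1 - p"
proof -
  let ?M = "\<Pi>\<^sub>M i\<in>{..<d}. (lborel :: real measure)"
  let ?L = "lborel_vec d"
  let ?B = "{x \<in> carrier_vec d. vnorm x \<le> 1}"
  let ?U = "uniform_measure ?L ?B"
  let ?n = "\<lambda>x. (1 / vnorm x) \<cdot>\<^sub>v x"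
  define a where "a = p / (12 * sqrt d)"
  define E where "E = {x \<in> sphere_vec d. a \<le> \<bar>x \<bullet> v\<bar>}"
  have a0: "a > 0" using p d by (simp add: a_def)
  have vv: "v \<in> carrier_vec d" "v \<bullet> v = 1" using v by (auto simp: sphere_vec_def)
  note [measurable] = vec_measurable_borel_vec vnorm_borel_vec scalar_prod_borel_vec[OF vv(1)]
  have setsL: "sets ?L = sets (borel_vec d)" and spaceL: "space ?L = carrier_vec d"
    by (auto simp: lborel_vec_def space_borel_vec)
  have B: "?B \<in> sets (borel_vec d)"
  proof -
    have "{x \<in> space (borel_vec d). vnorm x \<le> 1} \<in> sets (borel_vec d)" by measurable
    then show ?thesis by (simp add: space_borel_vec)
  qed
  have n: "?n \<in> measurable (borel_vec d) (borel_vec d)"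
  proof (rule measurable_borel_vecI)
    fix i assume [measurable]: "i < d"
    have "(\<lambda>x. (1 / vnorm x) * x $ i) \<in> borel_measurable (borel_vec d)" by measurable
    also have "?this \<longleftrightarrow> (\<lambda>x. ?n x $ i) \<in> borel_measurable (borel_vec d)"
      using \<open>i < d\<close> by (intro measurable_cong) (auto simp: space_borel_vec)
    finally show "(\<lambda>x. ?n x $ i) \<in> borel_measurable (borel_vec d)" .
  qed (simp add: space_borel_vec)
  have E: "E \<in> sets (borel_vec d)"
  proof -
    have "{x \<in> space (borel_vec d). vnorm x = 1 \<and> a \<le> \<bar>x \<bullet> v\<bar>} \<in> sets (borel_vec d)" by measurable
    also have "{x \<in> space (borel_vec d). vnorm x = 1 \<and> a \<le> \<bar>x \<bullet> v\<bar>} = E"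
      by (auto simp: E_def sphere_vec_def space_borel_vec vnorm_def)
    finally show ?thesis .
  qed
  have vol: "emeasure ?L S = emeasure ?M {f \<in> space ?M. vec d f \<in> S}" if "S \<in> sets (borel_vec d)" for S
    using that unfolding lborel_vec_def
    by (subst emeasure_distr) (auto intro!: arg_cong[of _ _ "emeasure ?M"])
  have sq: "vec d f \<bullet> vec d f = (\<Sum>i<d. (f i)\<^sup>2)" for f :: "nat \<Rightarrow> real"
    by (subst scalar_prod_sum_lessThan[of _ d]) (auto intro!: sum.cong simp: power2_eq_square)
  have volB: "emeasure ?L ?B = emeasure ?M {f \<in> space ?M. (\<Sum>i<d. (f i)\<^sup>2) \<le> 1}"
    by (subst vol[OF B]) (simp add: vnorm_def sq)
  also have "\<dots> = ennreal (unit_ball_vol d)"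
    using emeasure_cball_aux[of "{..<d}" 1] by (simp add: Int_def conj_commute)
  finally have B_pos: "emeasure ?L ?B \<noteq> 0" and B_fin: "emeasure ?L ?B \<noteq> \<infinity>"
    using unit_ball_vol_pos[of "real d"] by (auto simp del: unit_ball_vol_pos)
  have nU: "?n \<in> measurable ?U (borel_vec d)"
    using n by (subst measurable_cong_sets[OF _ refl]) (auto simp: setsL)
  have space: "space (uniform_sphere d) = carrier_vec d"
    by (simp add: uniform_sphere_def space_borel_vec)
  have total: "emeasure (uniform_sphere d) (carrier_vec d) = 1"
  proof -
    have "emeasure (uniform_sphere d) (space (borel_vec d)) = emeasure ?U (space ?U)"
      unfolding uniform_sphere_def
      by (subst emeasure_distr[OF nU])
         (use measurable_space[OF nU] in \<open>auto intro!: arg_cong[of _ _ "emeasure ?U"]\<close>)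
    also have "\<dots> = emeasure ?L (?B \<inter> space ?L) / emeasure ?L ?B"
      using B sets.top[of ?L] unfolding space_uniform_measure
      by (intro emeasure_uniform_measure) (auto simp: setsL)
    also have "?B \<inter> space ?L = ?B" by (auto simp: spaceL)
    finally show ?thesis using mult_divide_eq_ennreal[of "emeasure ?L ?B" 1] B_pos B_fin
      by (simp add: space_borel_vec)
  qed
  interpret S: finite_measure "uniform_sphere d"
    by (rule finite_measureI) (simp add: space total)
  let ?T = "{x \<in> carrier_vec d. vnorm x \<le> 1 \<and> \<bar>x \<bullet> v\<bar> < a}"
  have T: "?T \<in> sets (borel_vec d)"
  proof -
    have "{x \<in> space (borel_vec d). vnorm x \<le> 1 \<and> \<bar>x \<bullet> v\<bar> < a} \<in> sets (borel_vec d)" by measurable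
    then show ?thesis by (simp add: space_borel_vec)
  qed
  have "emeasure (uniform_sphere d) (carrier_vec d - E)
      = emeasure ?U (?n -` (carrier_vec d - E) \<inter> space ?U)"
    unfolding uniform_sphere_def using E
    by (intro emeasure_distr[OF nU]) (metis sets.compl_sets space_borel_vec)
  also have "\<dots> = emeasure ?L (?B \<inter> (?n -` (carrier_vec d - E) \<inter> space ?U)) / emeasure ?L ?B"
    using B E measurable_sets[OF nU, of "carrier_vec d - E"]
    by (intro emeasure_uniform_measure)
       (auto simp: setsL space_borel_vec[symmetric])
  also have "\<dots> \<le> emeasure ?L ?T / emeasure ?L ?B"
  proof (intro divide_right_mono_ennreal emeasure_mono subsetI)
    fix x assume "x \<in> ?B \<inter> (?n -` (carrier_vec d - E) \<inter> space ?U)"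
    then have x: "x \<in> carrier_vec d" "vnorm x \<le> 1" "?n x \<notin> E" by auto
    show "x \<in> ?T"
    proof (cases "vnorm x = 0")
      case True
      then have "x = 0\<^sub>v d"
        using conjugate_square_eq_0_vec[OF x(1)] by (simp add: vnorm_def)
      then show ?thesis using a0 vv True by simp
    next
      case False
      then have pos: "vnorm x > 0" using vnorm_nonneg[of x] by simp
      have "x \<bullet> x = vnorm x * vnorm x" by (simp add: vnorm_def scalar_prod_def sum_nonneg)
      then have "?n x \<in> sphere_vec d" using x(1) pos by (simp add: sphere_vec_def)
      then have "\<not> a \<le> \<bar>?n x \<bullet> v\<bar>" using x(3) by (simp add: E_def)
      then have "\<bar>x \<bullet> v\<bar> / vnorm x < a" using x(1) vv pos by (simp add: abs_mult)
      then have "\<bar>x \<bullet> v\<bar> < a * vnorm x" using pos by (simp add: pos_divide_less_eq)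
      also have "\<dots> \<le> a * 1" using a0 x(2) by (intro mult_left_mono) auto
      finally show ?thesis using x by simp
    qed
  qed (use T in \<open>simp add: setsL\<close>)
  also have "\<dots> \<le> ennreal p * emeasure ?L ?B / emeasure ?L ?B"
  proof (intro divide_right_mono_ennreal)
    have "(\<Sum>i<d. (v $ i)\<^sup>2) = 1"
      using vv by (simp add: scalar_prod_sum_lessThan[of _ d] power2_eq_square)
    from emeasure_ball_slab_le[of "{..<d}" "\<lambda>i. v $ i", OF _ _ this p] d
    have "emeasure ?M {f \<in> space ?M. (\<Sum>i<d. (f i)\<^sup>2) \<le> 1 \<and> \<bar>\<Sum>i<d. f i * v $ i\<bar> < a}
        \<le> ennreal p * emeasure ?M {f \<in> space ?M. (\<Sum>i<d. (f i)\<^sup>2) \<le> 1}"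
      by (simp add: a_def)
    then show "emeasure ?L ?T \<le> ennreal p * emeasure ?L ?B"
      unfolding volB by (subst vol[OF T]) (simp add: vnorm_def sq scalar_prod_sum_lessThan[OF vv(1)])
  qed
  also have "\<dots> = ennreal p"
    using B_pos B_fin by (simp add: mult_divide_eq_ennreal)
  finally have "measure (uniform_sphere d) (carrier_vec d - E) \<le> p"
    using p by (simp add: S.emeasure_eq_measure)
  moreover have "measure (uniform_sphere d) (space (uniform_sphere d) - E)
      = 1 - measure (uniform_sphere d) E"
  proof -
    have "E \<in> sets (uniform_sphere d)" using E by (simp add: uniform_sphere_def)
    then show ?thesis
      using S.finite_measure_compl[of E]
      by (simp add: measure_def[of _ "carrier_vec d"] space total)
  qed
  ultimately show ?thesis by (simp add: space E_def a_def)
qed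

section \<open>Gradient domination with high probability\<close>

theorem theorem4:
  shows "\<exists>C::real. C > 0 \<and>
    (\<forall>(d::nat) (n::nat) (z :: nat \<Rightarrow> real vec) (A :: real mat) (lam :: nat \<Rightarrow> real) (p::real).
       d \<ge> 2 \<longrightarrow>
       (\<forall>i\<in>{1..n}. z i \<in> carrier_vec d) \<longrightarrow>
       A = sum_outer d n z \<longrightarrow>
       char_poly A = (\<Prod>k=1..d. [:- lam k, 1:]) \<longrightarrow>
       lam 1 > lam 2 \<longrightarrow>
       (\<forall>j k. 2 \<le> j \<and> j \<le> k \<and> k \<le> d \<longrightarrow> lam j \<ge> lam k) \<longrightarrow>
       0 < p \<and> p < 1 \<longrightarrow>
       (\<exists>r>0.
          measure (uniform_sphere d)
            {x \<in> sphere_vec d. \<exists>m. is_arg_min (neg_quad_form A) (\<lambda>y. y \<in> sphere_vec d) m \<and>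
                                  x \<in> sphere_cball d m r} \<ge> 1 - p \<and>
          (\<forall>m. is_arg_min (neg_quad_form A) (\<lambda>y. y \<in> sphere_vec d) m \<longrightarrow>
               gradient_dominated_on d (neg_quad_form A)
                 (C * (real d / (p\<^sup>2 * (lam 1 - lam 2)))) (sphere_cball d m r))))"
proof (rule exI[of _ 36], intro conjI allI impI)
  fix d n :: nat and z :: "nat \<Rightarrow> real vec" and A :: "real mat" and lam :: "nat \<Rightarrow> real" and p :: real
  assume d: "d \<ge> 2" and z: "\<forall>i\<in>{1..n}. z i \<in> carrier_vec d" and A_def: "A = sum_outer d n z"
    and cp: "char_poly A = (\<Prod>k=1..d. [:- lam k, 1:])" and gap: "lam 1 > lam 2"
    and ord: "\<forall>j k. 2 \<le> j \<and> j \<le> k \<and> k \<le> d \<longrightarrow> lam j \<ge> lam k" and p: "0 < p \<and> p < 1"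
  have A: "A \<in> carrier_mat d d" "A\<^sup>T = A"
    using sum_outer_carrier transpose_sum_outer z by (auto simp: A_def)
  obtain v where v: "v \<in> carrier_vec d" "v \<bullet> v = 1" "A *\<^sub>v v = lam 1 \<cdot>\<^sub>v v"
    "\<And>x. x \<in> carrier_vec d \<Longrightarrow> x \<bullet> (A *\<^sub>v x) \<le> lam 1 * (x \<bullet> v)\<^sup>2 + lam 2 * (x \<bullet> x - (x \<bullet> v)\<^sup>2)"
    using ex_leading_eigenvector[OF d A cp ord] by metis
  have vs: "v \<in> sphere_vec d" using v by (simp add: sphere_vec_def)
  interpret leading_eigenvector d A v "lam 1" "lam 2"
    by unfold_locales (use A v vs gap in auto)
  define a where "a = p / (12 * sqrt d)"
  have sd: "sqrt d \<ge> 1" using d by simp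
  have a: "0 < a" "a < 1"
  proof -
    show "0 < a" using p sd by (simp add: a_def)
    have "p < 12 * sqrt d" using p sd by linarith
    then show "a < 1" using sd by (simp add: a_def)
  qed
  have ball: "sphere_cball d m (arccos a) = {x \<in> sphere_vec d. a \<le> m \<bullet> x}"
    if "m = v \<or> m = (- 1) \<cdot>\<^sub>v v" for m
    using that vs a by (intro sphere_cball_arccos[OF d]) (auto simp: sphere_vec_def)
  have caps: "{x \<in> sphere_vec d. \<exists>m. is_arg_min (neg_quad_form A) (\<lambda>y. y \<in> sphere_vec d) m \<and>
      x \<in> sphere_cball d m (arccos a)} = {x \<in> sphere_vec d. a \<le> \<bar>x \<bullet> v\<bar>}" (is "?L = ?R")
  proof -
    have "x \<in> ?L \<longleftrightarrow> x \<in> ?R" if x: "x \<in> sphere_vec d" for x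
    proof -
      have "x \<in> ?L \<longleftrightarrow> a \<le> v \<bullet> x \<or> a \<le> ((- 1) \<cdot>\<^sub>v v) \<bullet> x"
        using x ball unfolding is_arg_min_iff by blast
      moreover have "((- 1) \<cdot>\<^sub>v v) \<bullet> x = - (v \<bullet> x)" "x \<bullet> v = v \<bullet> x"
        using x v comm_scalar_prod[of x d v] by (auto simp: sphere_vec_def)
      then have "a \<le> \<bar>x \<bullet> v\<bar> \<longleftrightarrow> a \<le> v \<bullet> x \<or> a \<le> ((- 1) \<cdot>\<^sub>v v) \<bullet> x"
        by linarith
      ultimately show ?thesis using x by blast
    qed
    then show ?thesis by blast
  qed
  have tau: "1 / (4 * (lam 1 - lam 2) * a\<^sup>2) = 36 * (real d / (p\<^sup>2 * (lam 1 - lam 2)))"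
    using d p gap by (simp add: a_def power_divide power_mult_distrib field_simps)
  show "\<exists>r>0.
      measure (uniform_sphere d)
        {x \<in> sphere_vec d. \<exists>m. is_arg_min (neg_quad_form A) (\<lambda>y. y \<in> sphere_vec d) m \<and>
                              x \<in> sphere_cball d m r} \<ge> 1 - p \<and>
      (\<forall>m. is_arg_min (neg_quad_form A) (\<lambda>y. y \<in> sphere_vec d) m \<longrightarrow>
           gradient_dominated_on d (neg_quad_form A)
             (36 * (real d / (p\<^sup>2 * (lam 1 - lam 2)))) (sphere_cball d m r))"
  proof (intro exI[of _ "arccos a"] conjI allI impI)
    show "0 < arccos a" using arccos_less_arccos[of a 1] a by simp
    show "measure (uniform_sphere d)
        {x \<in> sphere_vec d. \<exists>m. is_arg_min (neg_quad_form A) (\<lambda>y. y \<in> sphere_vec d) m \<and>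
                              x \<in> sphere_cball d m (arccos a)} \<ge> 1 - p"
      unfolding caps unfolding a_def using measure_uniform_sphere_caps_ge[OF _ vs] d p by simp
    fix m assume "is_arg_min (neg_quad_form A) (\<lambda>y. y \<in> sphere_vec d) m"
    then have m: "m = v \<or> m = (- 1) \<cdot>\<^sub>v v" by (simp only: is_arg_min_iff)
    show "gradient_dominated_on d (neg_quad_form A)
        (36 * (real d / (p\<^sup>2 * (lam 1 - lam 2)))) (sphere_cball d m (arccos a))"
      using gradient_dominated_on_cap[OF m a(1)] unfolding tau ball[OF m] .
  qed
qed simp

end
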